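(* Let $\Gamma$ be a connected strongly regular graph with parameters $(v,k,\lambda,\mu)$, with Laplacian $L$ whose two distinct nonzero eigenvalues $r$ and $s$ (with multiplicities $f$ and $g$) are integers. Let $p$ be a prime dividing $|K(\Gamma)|$ and let $K_p(\Gamma)$ be the Sylow $p$-subgroup of the critical group $K(\Gamma)$. Suppose $p \nmid r$, and let $a,\gamma$ be the nonnegative integers with $p^a \parallel s$ and $p^\gamma \parallel v$. Then \[ K_p(\Gamma) \cong \mathbb{Z}/p^{a-\gamma}\mathbb{Z} \oplus (\mathbb{Z}/p^a\mathbb{Z})^{g-1}. \] The same statement holds with the roles of $r$ and $s$ interchanged and the roles of $f$ and $g$ interchanged.
   Context: A graph is strongly regular with parameters $(v,k,\lambda,\mu)$ if it has $v$ vertices, is $k$-regular, any two adjacent vertices have exactly $\lambda$ common neighbours, and any two non-adjacent vertices have exactly $\mu$ common neighbours. The Laplacian is $L = kI - A$, where $A$ is the adjacency matrix; $0$ is an eigenvalue of $L$ of multiplicity one and $L$ has exactly two other distinct eigenvalues $r,s$, with multiplicities $f,g$. Viewing $L$ as a map $\mathbb{Z}^{\mathcal{V}} \to \mathbb{Z}^{\mathcal{V}}$, its cokernel decomposes as $K(\Gamma) \oplus \mathbb{Z}$ with $K(\Gamma)$ finite abelian; $K(\Gamma)$ is the critical group. $p^a \parallel n$ means $p^a \mid n$ and $p^{a+1} \nmid n$. *)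

theory Defs
  imports "HOL-Algebra.Elementary_Groups" "HOL-Algebra.Product_Groups" "HOL-Algebra.Coset"
    "Jordan_Normal_Form.Char_Poly"
begin

definition simple_graph :: "nat \<Rightarrow> (nat \<Rightarrow> nat \<Rightarrow> bool) \<Rightarrow> bool" where
  "simple_graph n E \<longleftrightarrow> (\<forall>i j. E i j \<longrightarrow> i < n \<and> j < n) \<and> (\<forall>i j. E i j = E j i) \<and> (\<forall>i. \<not> E i i)"

definition degree :: "nat \<Rightarrow> (nat \<Rightarrow> nat \<Rightarrow> bool) \<Rightarrow> nat \<Rightarrow> nat" where
  "degree n E i = card {j. j < n \<and> E i j}"

definition common_nbrs :: "nat \<Rightarrow> (nat \<Rightarrow> nat \<Rightarrow> bool) \<Rightarrow> nat \<Rightarrow> nat \<Rightarrow> nat" where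
  "common_nbrs n E i j = card {c. c < n \<and> E i c \<and> E j c}"

definition strongly_regular ::
  "nat \<Rightarrow> (nat \<Rightarrow> nat \<Rightarrow> bool) \<Rightarrow> nat \<Rightarrow> nat \<Rightarrow> nat \<Rightarrow> bool" where
  "strongly_regular n E k l m \<longleftrightarrow> simple_graph n E
     \<and> (\<forall>i<n. degree n E i = k)
     \<and> (\<forall>i<n. \<forall>j<n. i \<noteq> j \<longrightarrow> E i j \<longrightarrow> common_nbrs n E i j = l)
     \<and> (\<forall>i<n. \<forall>j<n. i \<noteq> j \<longrightarrow> \<not> E i j \<longrightarrow> common_nbrs n E i j = m)"

definition connected_graph :: "nat \<Rightarrow> (nat \<Rightarrow> nat \<Rightarrow> bool) \<Rightarrow> bool" where
  "connected_graph n E \<longleftrightarrow> (\<forall>i<n. \<forall>j<n. E\<^sup>*\<^sup>* i j)"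

definition laplacian_mat :: "nat \<Rightarrow> (nat \<Rightarrow> nat \<Rightarrow> bool) \<Rightarrow> real mat" where
  "laplacian_mat n E = mat n n (\<lambda>(i,j). if i = j then real (degree n E i)
                                        else if E i j then -1 else 0)"

definition int_lattice :: "nat \<Rightarrow> (nat \<Rightarrow> int) monoid" where
  "int_lattice n = product_group {..<n} (\<lambda>_. integer_group)"

definition laplacian_map :: "nat \<Rightarrow> (nat \<Rightarrow> nat \<Rightarrow> bool) \<Rightarrow> (nat \<Rightarrow> int) \<Rightarrow> (nat \<Rightarrow> int)" where
  "laplacian_map n E x = (\<lambda>i\<in>{..<n}. int (degree n E i) * x i - (\<Sum>j | j < n \<and> E i j. x j))"

definition cokernel_L :: "nat \<Rightarrow> (nat \<Rightarrow> nat \<Rightarrow> bool) \<Rightarrow> (nat \<Rightarrow> int) set monoid" where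
  "cokernel_L n E = int_lattice n Mod (laplacian_map n E ` carrier (int_lattice n))"

definition torsion_subgroup :: "('a, 'b) monoid_scheme \<Rightarrow> ('a, 'b) monoid_scheme" where
  "torsion_subgroup G = G\<lparr>carrier := {x \<in> carrier G. \<exists>m::nat. m > 0 \<and> x [^]\<^bsub>G\<^esub> m = \<one>\<^bsub>G\<^esub>}\<rparr>"

definition critical_group :: "nat \<Rightarrow> (nat \<Rightarrow> nat \<Rightarrow> bool) \<Rightarrow> (nat \<Rightarrow> int) set monoid" where
  "critical_group n E = torsion_subgroup (cokernel_L n E)"

definition sylow_subgroup :: "('a, 'b) monoid_scheme \<Rightarrow> nat \<Rightarrow> 'a set \<Rightarrow> bool" where
  "sylow_subgroup G p P \<longleftrightarrow> subgroup P G \<and> card P = p ^ multiplicity p (card (carrier G))"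

end

theory Submission
  imports Defs "HOL-Algebra.Multiplicative_Group"
begin

text \<open>
  The Laplacian satisfies \<open>L\<^sup>2 = (r + s) L - r s + \<mu> J\<close> and \<open>r s = \<mu> v\<close>. Hence \<open>L - r\<close> maps
  integer vectors of coordinate sum \<open>0\<close> into the lattice \<open>W = {x. L x = s x}\<close>, and on the critical
  group it acts as \<open>- r\<close>, a unit at \<open>p\<close>. Writing \<open>s = p\<^sup>a s'\<close>, the map \<open>x \<mapsto> s' [x]\<close> therefore
  sends \<open>W\<close> onto the \<open>p\<close>-primary part of the critical group. Modulo \<open>p\<^sup>a W\<close> its kernel is
  generated by a multiple of \<open>u = (L - r) (v e - 1)\<close>, where \<open>e\<close> is a unit vector: the relation
  \<open>v (L - r) L e = s u\<close> puts \<open>p\<close> to the power \<open>a - \<gamma>\<close> times \<open>u\<close> into the kernel. If \<open>p\<close> divides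
  \<open>v\<close>, then \<open>u\<close> is nonzero modulo \<open>p\<close> and can be completed to a basis of \<open>W\<close> localised at \<open>p\<close>;
  if not, then \<open>\<gamma> = 0\<close> and \<open>u\<close> contributes nothing. Finally the rank of \<open>W\<close> is the multiplicity
  of \<open>s\<close>, because the all-one vector and bases of the two eigenlattices diagonalise \<open>L\<close>.
\<close>

section \<open>The Laplacian on integer and real vectors\<close>

text \<open>The constant \<open>k\<close> stands in for every vertex degree, and the ring is left
  open so that the same identities serve integer lattices and real eigenvectors.\<close>

definition lap :: "nat \<Rightarrow> (nat \<Rightarrow> nat \<Rightarrow> bool) \<Rightarrow> nat \<Rightarrow> (nat \<Rightarrow> 'a) \<Rightarrow> nat \<Rightarrow> 'a::comm_ring_1"
  where "lap v E k x i = of_nat k * x i - (\<Sum>j | j < v \<and> E i j. x j)"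

lemma lap_lincomb:
  "lap v E k (\<lambda>i. c * x i + d * y i) i = c * lap v E k x i + d * lap v E k y i"
  by (simp add: lap_def sum.distrib sum_distrib_left algebra_simps)

lemma lap_scale: "lap v E k (\<lambda>i. c * x i) i = c * lap v E k x i"
  using lap_lincomb[where d = 0] by simp

lemma lap_sum:
  "lap v E k (\<lambda>i. \<Sum>t\<in>T. c t * b t i) i = (\<Sum>t\<in>T. c t * lap v E k (b t) i)"
proof -
  have "(\<Sum>j | j < v \<and> E i j. \<Sum>t\<in>T. c t * b t j) = (\<Sum>t\<in>T. c t * (\<Sum>j | j < v \<and> E i j. b t j))"
    by (subst sum.swap) (simp add: sum_distrib_left)
  then show ?thesis
    by (simp add: lap_def sum_distrib_left right_diff_distrib sum_subtractf mult.left_commute)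
qed

lemma lap_cong:
  assumes "\<And>j. j < v \<Longrightarrow> x j = y j" "i < v"
  shows "lap v E k x i = lap v E k y i"
proof -
  have "(\<Sum>j | j < v \<and> E i j. x j) = (\<Sum>j | j < v \<and> E i j. y j)"
    by (rule sum.cong) (use assms in auto)
  then show ?thesis using assms by (simp add: lap_def)
qed

lemma lap_of_int: "lap v E k (\<lambda>i. of_int (x i)) i = of_int (lap v E k x i)"
  by (simp add: lap_def)

lemma nbr_sum_eq:
  fixes v :: nat
  shows
  "(\<Sum>j | j < v \<and> E i j. x j) = (\<Sum>j<v. of_bool (E i j) * (x j :: 'a::comm_ring_1))"
  by (rule sum.mono_neutral_cong_left) (auto simp: of_bool_def)

section \<open>The quadratic equation of the Laplacian\<close>

context
  fixes v k l m :: nat and E :: "nat \<Rightarrow> nat \<Rightarrow> bool"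
  assumes srg: "strongly_regular v E k l m"
begin

lemma E_sym: "E i j \<longleftrightarrow> E j i" and E_irrefl: "\<not> E i i"
  using srg by (auto simp: strongly_regular_def simple_graph_def)

lemma card_nbrs: "i < v \<Longrightarrow> card {j. j < v \<and> E i j} = k"
  using srg by (simp add: strongly_regular_def degree_def)

text \<open>The columns of the Laplacian sum to zero because adjacency is symmetric with constant
  degree \<open>k\<close>.\<close>

lemma sum_lap: "(\<Sum>i<v. lap v E k x i) = (0 :: 'a::comm_ring_1)"
proof -
  have "(\<Sum>i<v. \<Sum>j<v. of_bool (E i j) * x j) = (\<Sum>j<v. \<Sum>i<v. of_bool (E j i) * x j)"
    by (subst sum.swap) (simp only: E_sym)
  also have "\<dots> = (\<Sum>j<v. of_nat k * x j)"
  proof (intro sum.cong refl)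
    fix j assume "j \<in> {..<v}"
    then show "(\<Sum>i<v. of_bool (E j i) * x j) = of_nat k * x j"
      using nbr_sum_eq[of "\<lambda>_. x j" v E j] by (simp add: card_nbrs del: sum_of_bool_mult_eq)
  qed
  finally show ?thesis by (simp add: lap_def nbr_sum_eq sum_subtractf)
qed

lemma lap_const: "i < v \<Longrightarrow> lap v E k (\<lambda>_. c) i = (0 :: 'a::comm_ring_1)"
  by (simp add: lap_def card_nbrs)

text \<open>Entrywise form of \<open>A^2 = m J + (l - m) A + (k - m) I\<close> for the adjacency
  matrix \<open>A\<close>: walks of length two from \<open>i\<close> to \<open>t\<close> correspond
  to common neighbours, or to neighbours if \<open>t = i\<close>.\<close>

lemma paths2_eq:
  assumes "i < v" "t < v"
  shows "(\<Sum>j<v. of_bool (E i j) * of_bool (E j t)) =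
    (of_nat m + (of_nat l - of_nat m) * of_bool (E i t)
      + (of_nat k - of_nat m) * of_bool (t = i) :: 'a::comm_ring_1)"
proof -
  have "(\<Sum>j<v. of_bool (E i j) * of_bool (E j t) :: 'a) = (\<Sum>j<v. of_bool (E i j \<and> E t j) * 1)"
    by (intro sum.cong refl) (simp add: E_sym[of _ t] of_bool_conj)
  also have "\<dots> = of_nat (card {j. j < v \<and> E i j \<and> E t j})"
    using nbr_sum_eq[where x = "\<lambda>_. 1 :: 'a" and E = "\<lambda>i j. E i j \<and> E t j" and i = i and v = v] by simp
  also have "card {j. j < v \<and> E i j \<and> E t j} = (if t = i then k else if E i t then l else m)"
    using srg assms E_irrefl
    by (auto simp: strongly_regular_def degree_def common_nbrs_def)
  finally show ?thesis using E_irrefl by auto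
qed

text \<open>Expand \<open>(k I - A)^2\<close>, insert the formula for \<open>A^2\<close> and replace
  \<open>A\<close> by \<open>k I - L\<close>; the all-one matrix \<open>J\<close> leaves the
  coordinate sum.\<close>

lemma lap_lap:
  assumes "i < v"
  shows "lap v E k (lap v E k x) i = (2 * of_nat k - of_nat l + of_nat m) * lap v E k x i
    + ((of_nat l - of_nat m - of_nat k + 1) * of_nat k - of_nat m) * x i
    + of_nat m * (\<Sum>j<v. x j :: 'a::comm_ring_1)"
proof -
  define A where "A y i = (\<Sum>j<v. of_bool (E i j) * y j)" for y :: "nat \<Rightarrow> 'a" and i
  have lapA: "lap v E k y i = of_nat k * y i - A y i" for y i
    by (simp add: lap_def nbr_sum_eq A_def)
  have "A (A x) i = (\<Sum>t<v. (\<Sum>j<v. of_bool (E i j) * of_bool (E j t)) * x t)"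
    unfolding A_def sum_distrib_left sum_distrib_right mult.assoc by (rule sum.swap)
  also have "\<dots> = (\<Sum>t<v. of_nat m * x t + (of_nat l - of_nat m) * (of_bool (E i t) * x t)
      + (of_nat k - of_nat m) * (of_bool (t = i) * x t))"
    by (intro sum.cong refl)
      (simp add: paths2_eq assms distrib_right mult.assoc del: sum_of_bool_mult_eq sum_mult_of_bool_eq)
  also have "\<dots> = of_nat m * (\<Sum>t<v. x t) + (of_nat l - of_nat m) * A x i
      + (of_nat k - of_nat m) * (\<Sum>t<v. of_bool (t = i) * x t)"
    by (simp only: sum.distrib A_def sum_distrib_left)
  also have "(\<Sum>t<v. of_bool (t = i) * x t) = x i"
    using assms by (simp add: of_bool_def if_distrib if_distribR sum.delta cong: if_cong)
  finally have AA: "A (A x) i = of_nat m * (\<Sum>t<v. x t) + (of_nat l - of_nat m) * A x i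
      + (of_nat k - of_nat m) * x i" .
  have "A (lap v E k x) i = of_nat k * A x i - A (A x) i"
    by (simp add: A_def lapA right_diff_distrib sum_subtractf sum_distrib_left mult.left_commute
        del: sum_of_bool_mult_eq sum_mult_of_bool_eq)
  then show ?thesis by (simp add: lapA[of "lap v E k x"] AA lapA[of x] algebra_simps)
qed

end

section \<open>Echelon families in saturated lattices\<close>

text \<open>A family in a lattice of integer vectors in echelon form over the localisation of the
  integers at \<open>p\<close>.\<close>

definition pivoted :: "nat \<Rightarrow> int \<Rightarrow> ((nat \<Rightarrow> int) \<Rightarrow> bool) \<Rightarrow> (nat \<Rightarrow> nat \<Rightarrow> int) \<Rightarrow> (nat \<Rightarrow> nat) \<Rightarrow> nat \<Rightarrow> bool"
  where "pivoted v p W b j h \<longleftrightarrow>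
    (\<forall>i<h. W (b i) \<and> j i < v \<and> \<not> p dvd b i (j i) \<and> (\<forall>t<i. b i (j t) = 0))"

text \<open>Maximality is phrased through the pivots instead of a rank, so that a remainder cleared
  at all pivots by elimination is zero.\<close>

definition pivot_maximal :: "nat \<Rightarrow> ((nat \<Rightarrow> int) \<Rightarrow> bool) \<Rightarrow> (nat \<Rightarrow> nat) \<Rightarrow> nat \<Rightarrow> bool"
  where "pivot_maximal v W j h \<longleftrightarrow> (\<forall>x. W x \<longrightarrow> (\<forall>t<h. x (j t) = 0) \<longrightarrow> (\<forall>i<v. x i = 0))"

text \<open>Pivots are distinct: a later member vanishes at each earlier pivot but is not divisible
  by \<open>p\<close> at its own. The bound makes repeated extension terminate.\<close>

lemma pivoted_le:
  assumes "pivoted v p W b j h"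
  shows "h \<le> v"
proof -
  have "inj_on j {..<h}"
  proof (rule linorder_inj_onI')
    fix t i assume "t \<in> {..<h}" "i \<in> {..<h}" "t < i"
    then show "j t \<noteq> j i"
      using assms unfolding pivoted_def by (metis dvd_0_right lessThan_iff)
  qed
  moreover have "j ` {..<h} \<subseteq> {..<v}"
    using assms by (auto simp: pivoted_def)
  ultimately show ?thesis
    using card_inj_on_le[of j "{..<h}" "{..<v}"] by simp
qed

text \<open>Among the nonzero vectors of the lattice that vanish at all pivots, take one of least
  total absolute value. If \<open>p\<close> divided all its coordinates, saturation would allow
  dividing by \<open>p\<close>, giving a smaller one. Hence some coordinate is prime to
  \<open>p\<close> and becomes the new pivot.\<close>

lemma pivoted_extend:
  assumes piv: "pivoted v p W b j h" and max: "\<not> pivot_maximal v W j h"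
    and p: "prime p"
    and sat: "\<forall>x y. W x \<longrightarrow> (\<forall>i<v. x i = p * y i) \<longrightarrow> W y"
  shows "\<exists>b' j'. pivoted v p W b' j' (Suc h) \<and> (\<forall>i<h. b' i = b i \<and> j' i = j i)"
proof -
  define Q where "Q x \<longleftrightarrow> W x \<and> (\<forall>t<h. x (j t) = 0) \<and> (\<exists>i<v. x i \<noteq> 0)" for x
  obtain x0 where "Q x0" using max by (auto simp: pivot_maximal_def Q_def)
  define w where "w x = (\<Sum>i<v. nat \<bar>x i\<bar>)" for x :: "nat \<Rightarrow> int"
  obtain x where x: "Q x" and min: "\<And>y. Q y \<Longrightarrow> w x \<le> w y"
    using ex_has_least_nat[of Q x0 w] \<open>Q x0\<close> by blast
  have "\<exists>i<v. \<not> p dvd x i"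
  proof (rule ccontr)
    assume "\<not> ?thesis"
    then have d: "x i = p * (x i div p)" if "i < v" for i using that by simp
    have p2: "p \<ge> 2" using p by (simp add: prime_ge_2_int)
    define y where "y i = x i div p" for i
    have yx: "x i = p * y i" if "i < v" for i using d that by (simp add: y_def)
    have "j t < v" if "t < h" for t using piv that by (auto simp: pivoted_def)
    then have "Q y"
      using x sat[rule_format, of x y] yx p2 by (auto simp: Q_def)
    moreover have "w y < w x"
      unfolding w_def
    proof (rule sum_strict_mono_ex1)
      have *: "nat \<bar>x i\<bar> = nat p * nat \<bar>y i\<bar>" if "i < v" for i
        using yx[OF that] p2 by (simp add: abs_mult nat_mult_distrib)
      have **: "nat p \<ge> 2" using p2 by simp
      show "\<forall>i\<in>{..<v}. nat \<bar>y i\<bar> \<le> nat \<bar>x i\<bar>" using * ** by simp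
      obtain i where "i < v" "x i \<noteq> 0" using x by (auto simp: Q_def)
      then have "nat \<bar>y i\<bar> > 0" using yx by auto
      then have "nat \<bar>y i\<bar> < nat \<bar>x i\<bar>" using *[OF \<open>i < v\<close>] ** by simp
      then show "\<exists>i\<in>{..<v}. nat \<bar>y i\<bar> < nat \<bar>x i\<bar>" using \<open>i < v\<close> by blast
    qed simp
    ultimately show False using min by force
  qed
  then obtain i where "i < v" "\<not> p dvd x i" by blast
  then have "pivoted v p W (b(h := x)) (j(h := i)) (Suc h)"
    using piv x by (auto simp: pivoted_def Q_def less_Suc_eq)
  then show ?thesis by (intro exI conjI) auto
qed

text \<open>Extension is repeated until it is impossible. Keeping the given members is what later
  allows a prescribed vector to lead the family.\<close>

lemma pivoted_maximal_exists:
  assumes piv: "pivoted v p W b j h" and p: "prime p"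
    and sat: "\<forall>x y. W x \<longrightarrow> (\<forall>i<v. x i = p * y i) \<longrightarrow> W y"
  obtains b' j' h' where "pivoted v p W b' j' h'" "pivot_maximal v W j' h'" "h \<le> h'"
    "\<And>i. i < h \<Longrightarrow> b' i = b i"
  using piv
proof (induction "v - h" arbitrary: b j h thesis rule: less_induct)
  case less
  show ?case
  proof (cases "pivot_maximal v W j h")
    case True
    with less show ?thesis by blast
  next
    case False
    obtain b1 j1 where 1: "pivoted v p W b1 j1 (Suc h)" "\<And>i. i < h \<Longrightarrow> b1 i = b i"
      using pivoted_extend[OF less.prems(2) False p sat] by blast
    have "v - Suc h < v - h" using pivoted_le[OF 1(1)] by simp
    then obtain b' j' h' where "pivoted v p W b' j' h'" "pivot_maximal v W j' h'" "Suc h \<le> h'"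
      "\<And>i. i < Suc h \<Longrightarrow> b' i = b1 i"
      using less.hyps[OF _ _ 1(1)] by blast
    then show ?thesis using 1(2) by (intro less.prems(1)[of b' j' h']) auto
  qed
qed

text \<open>Gaussian elimination without division: each pivot is cleared by cross-multiplying with
  its entry, which is prime to \<open>p\<close>, so the accumulated factor \<open>N\<close> is a
  unit in the localisation. Maximality kills the final remainder.\<close>

lemma pivoted_spans:
  assumes piv: "pivoted v p W b j h" and max: "pivot_maximal v W j h" and p: "prime p"
    and lin: "\<And>x y c d. W x \<Longrightarrow> W y \<Longrightarrow> W (\<lambda>i. c * x i + d * y i)" and "W x"
  obtains N c where "\<not> p dvd N" "\<And>i. i < v \<Longrightarrow> N * x i = (\<Sum>t<h. c t * b t i)"
proof -
  have "\<exists>N c. \<not> p dvd N \<and> W (\<lambda>i. N * x i - (\<Sum>t<n. c t * b t i)) \<and>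
      (\<forall>u<n. N * x (j u) - (\<Sum>t<n. c t * b t (j u)) = 0)" if "n \<le> h" for n
    using that
  proof (induction n)
    case 0
    show ?case using \<open>W x\<close> p by (intro exI[of _ 1]) (auto simp: not_prime_unit)
  next
    case (Suc n)
    then obtain N c where N: "\<not> p dvd N" and W: "W (\<lambda>i. N * x i - (\<Sum>t<n. c t * b t i))"
      and z: "\<And>u. u < n \<Longrightarrow> N * x (j u) - (\<Sum>t<n. c t * b t (j u)) = 0" by auto
    define y where "y i = N * x i - (\<Sum>t<n. c t * b t i)" for i
    define e where "e = b n (j n)"
    have bn: "W (b n)" "\<not> p dvd e" "\<And>t. t < n \<Longrightarrow> b n (j t) = 0"
      using piv Suc.prems by (auto simp: pivoted_def e_def)
    \<comment> \<open>The old remainder \<open>y\<close> is scaled by the pivot entry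
      \<open>e\<close>, and \<open>y (j n)\<close> times \<open>b n\<close> is subtracted. Earlier
      pivots stay cleared because \<open>b n\<close> vanishes there.\<close>
    define c' where "c' t = (if t = n then y (j n) else e * c t)" for t
    have eq: "e * N * x i - (\<Sum>t<Suc n. c' t * b t i) = e * y i + (- y (j n)) * b n i" for i
      by (simp add: c'_def y_def sum_distrib_left algebra_simps)
    show ?case
    proof (intro exI conjI)
      show "\<not> p dvd e * N" using p N bn by (simp add: prime_dvd_mult_iff)
      show "W (\<lambda>i. e * N * x i - (\<Sum>t<Suc n. c' t * b t i))"
        unfolding eq using W bn by (intro lin) (auto simp: y_def)
      show "\<forall>u<Suc n. e * N * x (j u) - (\<Sum>t<Suc n. c' t * b t (j u)) = 0"
        unfolding eq using bn z by (auto simp: less_Suc_eq e_def y_def algebra_simps)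
    qed
  qed
  from this[of h] obtain N c where N: "\<not> p dvd N" and W: "W (\<lambda>i. N * x i - (\<Sum>t<h. c t * b t i))"
      and z: "\<forall>u<h. N * x (j u) - (\<Sum>t<h. c t * b t (j u)) = 0" by blast
  have "\<forall>i<v. N * x i - (\<Sum>t<h. c t * b t i) = 0"
    using max W z unfolding pivot_maximal_def by (elim allE[of _ "\<lambda>i. N * x i - (\<Sum>t<h. c t * b t i)"]) blast
  then show ?thesis by (intro that[OF N]) auto
qed

section \<open>Independence of echelon families\<close>

lemma sum_pivot_split:
  assumes piv: "pivoted v p W b j h" and "t < h"
  shows "(\<Sum>u<h. c u * of_int (b u (j t))) =
    (\<Sum>u<t. c u * of_int (b u (j t))) + c t * (of_int (b t (j t)) :: 'a::comm_ring_1)"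
proof -
  have "(\<Sum>u<h. c u * of_int (b u (j t))) = (\<Sum>u<Suc t. c u * (of_int (b u (j t)) :: 'a))"
    by (rule sum.mono_neutral_right) (use assms in \<open>auto simp: pivoted_def\<close>)
  then show ?thesis by simp
qed

text \<open>Forward substitution: at the pivot \<open>j t\<close> only members up to
  \<open>t\<close> contribute, and the entry of \<open>b t\<close> there is a unit modulo
  \<open>p ^ a\<close>.\<close>

lemma pivoted_independent_mod:
  assumes piv: "pivoted v p W b j h" and p: "prime p"
    and dvd: "\<And>i. i < v \<Longrightarrow> p ^ a dvd (\<Sum>t<h. c t * b t i)" and "t < h"
  shows "p ^ a dvd c t"
  using \<open>t < h\<close>
proof (induction t rule: less_induct)
  case (less t)
  have jt: "j t < v" "\<not> p dvd b t (j t)" using piv less.prems by (auto simp: pivoted_def)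
  have "p ^ a dvd (\<Sum>u<t. c u * b u (j t)) + c t * b t (j t)"
    using dvd[OF jt(1)] sum_pivot_split[OF piv less.prems, of c] by simp
  moreover have "p ^ a dvd (\<Sum>u<t. c u * b u (j t))"
    using less by (intro dvd_sum) auto
  ultimately have "p ^ a dvd c t * b t (j t)" using dvd_add_right_iff by blast
  moreover have "coprime (p ^ a) (b t (j t))"
    using p jt by (simp add: prime_imp_coprime)
  ultimately show ?case by (simp add: coprime_dvd_mult_left_iff)
qed

text \<open>The same substitution over a field of characteristic zero, where it suffices that the
  pivot entries are nonzero.\<close>

lemma pivoted_independent:
  fixes c :: "nat \<Rightarrow> 'a::field_char_0"
  assumes piv: "pivoted v p W b j h"
    and z: "\<And>i. i < v \<Longrightarrow> (\<Sum>t<h. c t * of_int (b t i)) = 0" and "t < h"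
  shows "c t = 0"
  using \<open>t < h\<close>
proof (induction t rule: less_induct)
  case (less t)
  have jt: "j t < v" "b t (j t) \<noteq> 0" using piv less.prems by (auto simp: pivoted_def)
  have "(\<Sum>u<t. c u * of_int (b u (j t))) = 0"
    using less by (intro sum.neutral) auto
  then show ?case
    using z[OF jt(1)] sum_pivot_split[OF piv less.prems, of c] jt by simp
qed

section \<open>Eigenlattices and multiplicities\<close>

text \<open>The eigenbasis \<open>S\<close> has a left and a right inverse \<open>T\<close>; comparing the traces of
  \<open>S T\<close> and \<open>T S\<close> shows that it has exactly \<open>v\<close> members.\<close>

lemma order_char_poly_eigenbasis:
  fixes A :: "'a::field_char_0 mat" and n :: nat
  assumes A: "A \<in> carrier_mat v v"
    and eig: "\<And>j i. j < n \<Longrightarrow> i < v \<Longrightarrow> (\<Sum>t<v. A $$ (i,t) * S j t) = d j * S j i"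
    and indep: "\<And>c j. (\<And>i. i < v \<Longrightarrow> (\<Sum>j<n. c j * S j i) = 0) \<Longrightarrow> j < n \<Longrightarrow> c j = 0"
    and span: "\<And>i0. i0 < v \<Longrightarrow> \<exists>c. \<forall>i<v. (\<Sum>j<n. c j * S j i) = of_bool (i = i0)"
  shows "Polynomial.order e (char_poly A) = card {j. j < n \<and> d j = e}"
proof -
  from span obtain T where T: "\<And>i0 i. i0 < v \<Longrightarrow> i < v \<Longrightarrow> (\<Sum>j<n. T i0 j * S j i) = of_bool (i = i0)"
    by metis
  \<comment> \<open>As matrices, \<open>T S = 1\<close> gives \<open>S T S = S\<close>; independence
    of the rows of \<open>S\<close> then gives \<open>S T = 1\<close>.\<close>
  have TS: "(\<Sum>i<v. S u i * T i j) = of_bool (j = u)" if "u < n" "j < n" for u j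
  proof -
    have "(\<Sum>i<v. S u i * T i j) - of_bool (j = u) = 0"
    proof (rule indep[OF _ that(2)])
      fix q assume q: "q < v"
      have "(\<Sum>j<n. (\<Sum>i<v. S u i * T i j) * S j q) = (\<Sum>i<v. S u i * (\<Sum>j<n. T i j * S j q))"
        unfolding sum_distrib_left sum_distrib_right mult.assoc by (rule sum.swap)
      also have "\<dots> = (\<Sum>i<v. S u i * of_bool (q = i))"
        by (intro sum.cong refl) (simp add: T q)
      also have "\<dots> = S u q"
        using q by (simp add: Int_absorb1)
      finally have 1: "(\<Sum>j<n. (\<Sum>i<v. S u i * T i j) * S j q) = S u q" .
      have "(\<Sum>j<n. of_bool (j = u) * S j q) = S u q"
        using that by (simp add: Int_absorb1)
      with 1 show "(\<Sum>j<n. ((\<Sum>i<v. S u i * T i j) - of_bool (j = u)) * S j q) = 0"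
        by (simp only: left_diff_distrib sum_subtractf) simp
    qed
    then show ?thesis by simp
  qed
  have "(of_nat n :: 'a) = (\<Sum>j<n. \<Sum>i<v. S j i * T i j)" by (simp add: TS)
  also have "\<dots> = (\<Sum>i<v. \<Sum>j<n. T i j * S j i)" by (subst sum.swap) (simp add: mult.commute)
  also have "\<dots> = of_nat v" by (simp add: T)
  finally have nv: "n = v" by simp
  define P where "P = mat v v (\<lambda>(i,j). S j i)"
  define Q where "Q = mat v v (\<lambda>(j,i). T i j)"
  define D where "D = mat v v (\<lambda>(i,j). if i = j then d j else 0)"
  have carr: "P \<in> carrier_mat v v" "Q \<in> carrier_mat v v" "D \<in> carrier_mat v v"
    by (auto simp: P_def Q_def D_def)
  have PQ: "P * Q = 1\<^sub>m v"
    by (rule eq_matI) (use T nv in \<open>auto simp: P_def Q_def scalar_prod_def atLeast0LessThan mult.commute\<close>)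
  have QP: "Q * P = 1\<^sub>m v"
    by (rule eq_matI) (use TS nv in \<open>auto simp: P_def Q_def scalar_prod_def atLeast0LessThan mult.commute\<close>)
  have PD: "P * D = mat v v (\<lambda>(i,j). S j i * d j)"
    by (rule eq_matI) (auto simp: P_def D_def scalar_prod_def atLeast0LessThan if_distrib if_distribR sum.delta cong: if_cong)
  have D_upper: "upper_triangular D" by (auto simp: D_def)
  have "A * P = P * D"
    unfolding PD by (rule eq_matI) (use eig nv A in \<open>auto simp: P_def scalar_prod_def atLeast0LessThan mult.commute\<close>)
  then have "A = P * D * Q"
    using A carr PQ by (metis assoc_mult_mat right_mult_one_mat)
  then have "similar_mat A D"
    unfolding similar_mat_def similar_mat_wit_def Let_def
    using A carr PQ QP by (intro exI[of _ P] exI[of _ Q]) auto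
  then have "char_poly A = char_poly D" by (rule char_poly_similar)
  also have "\<dots> = (\<Prod>a\<leftarrow>diag_mat D. [:- a, 1:])"
    by (rule char_poly_upper_triangular[OF carr(3) D_upper])
  also have "diag_mat D = map d [0..<n]" by (auto simp: D_def diag_mat_def nv)
  finally have cp: "char_poly A = (\<Prod>a\<leftarrow>map d [0..<n]. [:- a, 1:])" .
  have "Polynomial.order e (\<Prod>a\<leftarrow>xs. [:- a, 1:]) = count_list xs e" for xs
  proof (induction xs)
    case (Cons a xs)
    have nz: "(\<Prod>a\<leftarrow>xs. [:- a, 1:]) \<noteq> 0" by (auto simp: prod_list_zero_iff)
    have "Polynomial.order e [:- a, 1:] = of_bool (a = e)"
      using order_power_n_n[of e 1] by (auto simp: order_0I)
    moreover have "[:- a, 1:] * (\<Prod>a\<leftarrow>xs. [:- a, 1:]) \<noteq> 0"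
      using nz by (simp only: mult_eq_0_iff) simp
    ultimately show ?case using Cons by (simp add: order_mult del: mult_pCons_left)
  qed simp
  then have "Polynomial.order e (char_poly A) = count_list (map d [0..<n]) e" by (simp only: cp)
  also have "\<dots> = card {j. j < n \<and> d j = e}"
    by (auto simp: count_list_eq_length_filter filter_map o_def length_filter_conv_card
        intro!: arg_cong[where f = card])
  finally show ?thesis .
qed

section \<open>Laplacian matrix and eigenlattices of a strongly regular graph\<close>

lemma sum_laplacian_mat:
  assumes srg: "strongly_regular v E k l m" and "i < v"
  shows "(\<Sum>u<v. laplacian_mat v E $$ (i,u) * x u) = lap v E k x i"
proof -
  have "(\<Sum>u<v. laplacian_mat v E $$ (i,u) * x u) =
      (\<Sum>u<v. (if u = i then real k * x u else 0) - of_bool (E i u) * x u)"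
    using assms E_irrefl[OF srg]
    by (intro sum.cong refl) (auto simp: laplacian_mat_def strongly_regular_def)
  also have "\<dots> = lap v E k x i"
    unfolding sum_subtractf using assms(2) by (simp add: lap_def nbr_sum_eq sum.delta' del: sum_of_bool_mult_eq)
  finally show ?thesis .
qed

text \<open>The last two assumptions are Vieta's formulas for the quadratic in
  \<open>lap_lap\<close> with roots \<open>r\<close> and \<open>s\<close>. All assumptions are
  symmetric in \<open>r\<close> and \<open>s\<close>, so the locale can be interpreted with the two
  exchanged.\<close>

locale integral_srg =
  fixes v k l m :: nat and E :: "nat \<Rightarrow> nat \<Rightarrow> bool" and r s :: int
  assumes srg: "strongly_regular v E k l m" and v_pos: "v > 0"
    and rs: "r \<noteq> s" "r \<noteq> 0" "s \<noteq> 0"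
    and trace_eq: "2 * int k - int l + int m = r + s"
    and norm_eq: "(int l - int m - int k + 1) * int k - int m = - (r * s)"
begin

abbreviation L :: "(nat \<Rightarrow> 'a) \<Rightarrow> nat \<Rightarrow> 'a::comm_ring_1" where "L \<equiv> lap v E k"

lemma L_L: "i < v \<Longrightarrow> L (L x) i = (r + s) * L x i - r * s * x i + int m * (\<Sum>j<v. x j)"
  using lap_lap[OF srg, of i x] trace_eq norm_eq by simp

text \<open>Apply the quadratic equation to the all-one vector, which \<open>L\<close>
  annihilates.\<close>

lemma rs_eq: "r * s = int m * int v"
  using L_L[OF v_pos, of "\<lambda>_. 1"] v_pos
  by (simp add: lap_cong[of v "L (\<lambda>_. 1)" "\<lambda>_. 0"] lap_const[OF srg])

definition eigvec :: "int \<Rightarrow> (nat \<Rightarrow> int) \<Rightarrow> bool" where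
  "eigvec t x \<longleftrightarrow> (\<forall>i<v. L x i = t * x i)"

lemma eigvec_lincomb: "eigvec t x \<Longrightarrow> eigvec t y \<Longrightarrow> eigvec t (\<lambda>i. c * x i + d * y i)"
  by (auto simp: eigvec_def lap_lincomb algebra_simps)

text \<open>Cancelling \<open>q\<close> in the eigenvector equation gives the saturation that the
  extension of echelon families requires.\<close>

lemma eigvec_saturated:
  assumes "q \<noteq> 0"
  shows "\<forall>x y. eigvec t x \<longrightarrow> (\<forall>i<v. x i = q * y i) \<longrightarrow> eigvec t y"
proof (intro allI impI)
  fix x y assume x: "eigvec t x" and xy: "\<forall>i<v. x i = q * y i"
  have "q * L y i = q * (t * y i)" if "i < v" for i
    using x that xy lap_cong[of v x "\<lambda>i. q * y i" i E k]
    by (auto simp: eigvec_def lap_scale mult.left_commute)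
  then show "eigvec t y" using assms by (simp add: eigvec_def)
qed

lemma eigvec_sum_zero: "eigvec t x \<Longrightarrow> t \<noteq> 0 \<Longrightarrow> (\<Sum>i<v. x i) = 0"
  using sum_lap[OF srg, of x] by (simp add: eigvec_def flip: sum_distrib_left)

lemma L_minus_scale: "L (\<lambda>i. L x i - c * x i) i = L (L x) i - c * L x i"
  using lap_lincomb[of v E k 1 "L x" "-c" x i] by simp

text \<open>On vectors of sum zero the quadratic equation reads \<open>(L - r) (L - s) = 0\<close>,
  so each factor maps into the eigenlattice of the other root.\<close>

lemma eigvec_s_proj: "(\<Sum>i<v. z i) = 0 \<Longrightarrow> eigvec s (\<lambda>i. L z i - r * z i)"
  and eigvec_r_proj: "(\<Sum>i<v. z i) = 0 \<Longrightarrow> eigvec r (\<lambda>i. L z i - s * z i)"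
  by (auto simp: eigvec_def L_minus_scale L_L algebra_simps)

text \<open>The \<open>s\<close>-family, a maximal \<open>r\<close>-family and the all-one vector,
  in this order, form a real eigenbasis; exactly the first \<open>h\<close> members have eigenvalue
  \<open>s\<close>.\<close>

lemma order_char_poly_s:
  assumes p: "prime p" and piv: "pivoted v p (eigvec s) b j h" and max: "pivot_maximal v (eigvec s) j h"
  shows "Polynomial.order (real_of_int s) (char_poly (laplacian_mat v E)) = h"
proof -
  have p0: "p \<noteq> 0" using p by auto
  have "pivoted v p (eigvec r) b j 0" by (simp add: pivoted_def)
  then obtain b' j' h' where piv': "pivoted v p (eigvec r) b' j' h'"
      and max': "pivot_maximal v (eigvec r) j' h'"
    using pivoted_maximal_exists[OF _ p eigvec_saturated[OF p0]] by metis
  define n where "n = Suc (h + h')"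
  define S where "S t i = (if t < h then real_of_int (b t i) else
      if t < h + h' then real_of_int (b' (t - h) i) else 1)" for t i
  define d where "d t = (if t < h then real_of_int s else if t < h + h' then real_of_int r else 0)" for t
  have split: "(\<Sum>t<n. c t * S t i) = (\<Sum>t<h. c t * real_of_int (b t i))
      + (\<Sum>t<h'. c (h + t) * real_of_int (b' t i)) + c (h + h')" for c i
  proof -
    have "(\<Sum>t<h + h'. c t * S t i) = (\<Sum>t<h. c t * S t i) + (\<Sum>t=h..<h + h'. c t * S t i)"
      using sum.atLeastLessThan_concat[of 0 h "h + h'" "\<lambda>t. c t * S t i"] by (simp add: atLeast0LessThan)
    also have "(\<Sum>t=h..<h + h'. c t * S t i) = (\<Sum>t<h'. c (h + t) * S (h + t) i)"
      using sum.shift_bounds_nat_ivl[of "\<lambda>t. c t * S t i" 0 h h'] by (simp add: atLeast0LessThan add.commute)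
    finally show ?thesis by (simp add: n_def S_def)
  qed
  have ev: "L (\<lambda>i. real_of_int (b t i)) i = real_of_int s * real_of_int (b t i)" if "t < h" "i < v" for t i
    using piv that by (simp add: pivoted_def eigvec_def lap_of_int)
  have ev': "L (\<lambda>i. real_of_int (b' t i)) i = real_of_int r * real_of_int (b' t i)" if "t < h'" "i < v" for t i
    using piv' that by (simp add: pivoted_def eigvec_def lap_of_int)
  have "Polynomial.order (real_of_int s) (char_poly (laplacian_mat v E)) = card {t. t < n \<and> d t = s}"
  proof (rule order_char_poly_eigenbasis[where S = S])
    show "laplacian_mat v E \<in> carrier_mat v v" by (simp add: laplacian_mat_def)
  next
    fix t i assume t: "t < n" and i: "i < v"
    show "(\<Sum>u<v. laplacian_mat v E $$ (i, u) * S t u) = d t * S t i"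
      using t i ev[of t i] ev'[of "t - h" i] lap_const[OF srg i, of "1 :: real"]
        sum_laplacian_mat[OF srg i, of "S t"]
      by (auto simp: S_def[abs_def] d_def n_def)
  next
    fix c t assume z: "\<And>i. i < v \<Longrightarrow> (\<Sum>t<n. c t * S t i) = 0" and t: "t < n"
    define y where "y i = (\<Sum>t<h. c t * real_of_int (b t i))" for i
    define y' where "y' i = (\<Sum>t<h'. c (h + t) * real_of_int (b' t i))" for i
    have Ly: "L y i = s * y i" "L y' i = r * y' i" if "i < v" for i
      using that by (simp_all add: y_def[abs_def] y'_def[abs_def] lap_sum ev ev' sum_distrib_left mult.left_commute)
    have y: "y i + y' i + c (h + h') = 0" if "i < v" for i using z[OF that] split by (simp add: y_def y'_def)
    \<comment> \<open>Applying \<open>L\<close> to the relation removes the constant term. A second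
      application gives another linear equation, and the two force \<open>y\<close> and
      \<open>y'\<close> to vanish because \<open>r\<close> and \<open>s\<close> are distinct and
      nonzero.\<close>
    have "s * y i + r * y' i = 0" if "i < v" for i
    proof -
      have "L (\<lambda>i. 1 * y i + 1 * y' i) i = L (\<lambda>_. - c (h + h')) i"
        by (rule lap_cong[OF _ that]) (use y in \<open>simp add: eq_neg_iff_add_eq_0\<close>)
      then show ?thesis using Ly[OF that] lap_const[OF srg that] by (simp only: lap_lincomb) simp
    qed
    moreover from this have "s * s * y i + r * r * y' i = 0" if "i < v" for i
    proof -
      have "L (\<lambda>i. s * y i + r * y' i) i = L (\<lambda>_. 0) i"
        by (rule lap_cong[OF _ that]) (use \<open>\<And>i. i < v \<Longrightarrow> s * y i + r * y' i = 0\<close> in simp)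
      then show ?thesis using Ly[OF that] lap_const[OF srg that, of "0 :: real"]
        by (simp only: lap_lincomb of_int_mult mult.assoc)
    qed
    ultimately have yz: "y i = 0 \<and> y' i = 0" if "i < v" for i
    proof -
      assume 1: "\<And>i. i < v \<Longrightarrow> s * y i + r * y' i = 0"
        and 2: "\<And>i. i < v \<Longrightarrow> s * s * y i + r * r * y' i = 0"
      have "s * (s - r) * y i = (s * s * y i + r * r * y' i) - r * (s * y i + r * y' i)"
        by (simp add: algebra_simps)
      then have "y i = 0" using 1[OF that] 2[OF that] rs by simp
      then show ?thesis using 1[OF that] rs by simp
    qed
    then have "c (h + h') = 0" using y v_pos by force
    moreover have "c u = 0" if "u < h" for u
      using pivoted_independent[OF piv _ that, of c] yz by (simp add: y_def)
    moreover have "c (h + u) = 0" if "u < h'" for u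
      using pivoted_independent[OF piv' _ that, of "\<lambda>u. c (h + u)"] yz by (simp add: y'_def)
    ultimately show "c t = 0"
      using t by (auto simp: n_def less_Suc_eq) (metis add_diff_inverse_nat nat_add_left_cancel_less)
  next
    fix i0 assume i0: "i0 < v"
    define e :: "nat \<Rightarrow> int" where "e i = of_bool (i = i0)" for i
    \<comment> \<open>The unit vector is \<open>e = (z + 1) / v\<close>, where \<open>z\<close> has
      sum zero and \<open>(s - r) z = (L - r) z - (L - s) z\<close> splits it into eigenvectors. The
      coefficients \<open>C\<close> below divide out \<open>s - r\<close>, \<open>v\<close> and the
      factors \<open>N\<close>, \<open>N'\<close> left by elimination.\<close>
    define z where "z i = int v * e i - 1" for i
    have "(\<Sum>i<v. e i) = 1" using i0 by (simp add: e_def Int_absorb1)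
    then have sz: "(\<Sum>i<v. z i) = 0" by (simp add: z_def sum_subtractf flip: sum_distrib_left)
    obtain N c where N: "\<not> p dvd N" and c: "\<And>i. i < v \<Longrightarrow> N * (L z i - r * z i) = (\<Sum>t<h. c t * b t i)"
      using pivoted_spans[OF piv max p eigvec_lincomb eigvec_s_proj[OF sz]] by metis
    obtain N' c' where N': "\<not> p dvd N'" and c': "\<And>i. i < v \<Longrightarrow> N' * (L z i - s * z i) = (\<Sum>t<h'. c' t * b' t i)"
      using pivoted_spans[OF piv' max' p eigvec_lincomb eigvec_r_proj[OF sz]] by metis
    have nz: "N \<noteq> 0" "N' \<noteq> 0" using N N' by auto
    define q where "q = real_of_int (s - r) * v"
    have q: "q \<noteq> 0" using rs v_pos by (simp add: q_def)
    define C where "C t = (if t < h then c t / (N * q) else if t < h + h' then - c' (t - h) / (N' * q) else 1 / v)" for t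
    have "(\<Sum>t<n. C t * S t i) = of_bool (i = i0)" if i: "i < v" for i
    proof -
      have "(\<Sum>t<h. C t * b t i) = (\<Sum>t<h. c t * b t i) / (N * q)"
        by (simp add: C_def sum_divide_distrib)
      also have "\<dots> = (L z i - r * z i) / q" using nz by (simp flip: c[OF i])
      finally have 1: "(\<Sum>t<h. C t * b t i) = (L z i - r * z i) / q" .
      have "(\<Sum>t<h'. C (h + t) * b' t i) = - (\<Sum>t<h'. c' t * b' t i) / (N' * q)"
        by (simp add: C_def sum_divide_distrib sum_negf)
      also have "\<dots> = - ((N' * (L z i - s * z i)) / (N' * q))" by (simp flip: c'[OF i])
      also have "\<dots> = - (L z i - s * z i) / q" using nz by (simp add: minus_divide_left)
      finally have 2: "(\<Sum>t<h'. C (h + t) * b' t i) = - (L z i - s * z i) / q" .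
      have "C (h + h') = 1 / v" by (simp add: C_def)
      then have "(\<Sum>t<n. C t * S t i) = (L z i - r * z i) / q - (L z i - s * z i) / q + 1 / v"
        unfolding split 1 2 by (simp only: minus_divide_left[symmetric] diff_conv_add_uminus)
      also have "\<dots> = (s - r) * z i / q + 1 / v" by (simp add: algebra_simps flip: diff_divide_distrib)
      also have "\<dots> = e i" using rs v_pos by (simp add: q_def z_def field_simps)
      finally show ?thesis by (simp add: e_def)
    qed
    then show "\<exists>c. \<forall>i<v. (\<Sum>t<n. c t * S t i) = of_bool (i = i0)" by blast
  qed
  also have "{t. t < n \<and> d t = s} = {..<h}" using rs by (auto simp: n_def d_def)
  finally show ?thesis by simp
qed

end

text \<open>An eigenvector for a nonzero eigenvalue has coordinate sum zero, so the last term of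
  \<open>lap_lap\<close> disappears; comparing at a nonzero coordinate gives the equation.\<close>

lemma eigenvalue_quadratic:
  assumes srg: "strongly_regular v E k l m" and t: "t \<noteq> 0"
    and eig: "eigenvalue (laplacian_mat v E) (real_of_int t)"
  shows "t\<^sup>2 = (2 * int k - int l + int m) * t + ((int l - int m - int k + 1) * int k - int m)"
    and "v > 0"
proof -
  have dim: "dim_row (laplacian_mat v E) = v" "dim_col (laplacian_mat v E) = v"
    by (simp_all add: laplacian_mat_def)
  obtain w where w: "w \<in> carrier_vec v" "w \<noteq> 0\<^sub>v v"
      "laplacian_mat v E *\<^sub>v w = real_of_int t \<cdot>\<^sub>v w"
    using eig by (auto simp: eigenvalue_def eigenvector_def dim)
  define x where "x i = w $ i" for i
  obtain i where i: "i < v" "x i \<noteq> 0"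
    using w(1,2) by (auto simp: x_def vec_eq_iff)
  then show "v > 0" by simp
  have Lx: "lap v E k x i = t * x i" if "i < v" for i
  proof -
    have "lap v E k x i = (laplacian_mat v E *\<^sub>v w) $ i"
      using that w(1) by (simp add: x_def scalar_prod_def dim atLeast0LessThan
          flip: sum_laplacian_mat[OF srg that])
    then show ?thesis using that w by (simp add: x_def)
  qed
  have "(\<Sum>j<v. x j) = 0"
    using sum_lap[OF srg, of x] t by (simp add: Lx flip: sum_distrib_left)
  moreover have "lap v E k (lap v E k x) i = t * (t * x i)"
    using lap_cong[of v "lap v E k x" "\<lambda>j. t * x j" i E k] Lx i by (simp add: lap_scale)
  ultimately have "real_of_int (t\<^sup>2) * x i = real_of_int ((2 * int k - int l + int m) * t
      + ((int l - int m - int k + 1) * int k - int m)) * x i"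
    using lap_lap[OF srg i(1), of x] Lx[OF i(1)] by (simp add: power2_eq_square algebra_simps)
  then show "t\<^sup>2 = (2 * int k - int l + int m) * t + ((int l - int m - int k + 1) * int k - int m)"
    using i(2) mult_right_cancel of_int_eq_iff by blast
qed

text \<open>Two distinct roots determine a monic quadratic: subtracting the equations gives the sum
  of the roots, and then the product follows.\<close>

lemma integral_srgI:
  assumes srg: "strongly_regular v E k l m"
    and rs: "r \<noteq> s" "r \<noteq> 0" "s \<noteq> 0"
    and eig_r: "eigenvalue (laplacian_mat v E) (real_of_int r)"
    and eig_s: "eigenvalue (laplacian_mat v E) (real_of_int s)"
  shows "integral_srg v k l m E r s"
proof -
  define a where "a = 2 * int k - int l + int m"
  define c where "c = (int l - int m - int k + 1) * int k - int m"
  have r: "r\<^sup>2 = a * r + c" and s: "s\<^sup>2 = a * s + c"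
    using eigenvalue_quadratic(1)[OF srg _ eig_r] eigenvalue_quadratic(1)[OF srg _ eig_s] rs
    by (simp_all add: a_def c_def)
  have "(r - s) * (r + s - a) = 0"
    using r s by (simp add: power2_eq_square algebra_simps)
  then have a: "a = r + s" using rs by simp
  then have "c = - (r * s)" using r by (simp add: power2_eq_square algebra_simps)
  then show ?thesis
    using a srg rs eigenvalue_quadratic(2)[OF srg rs(2) eig_r]
    by unfold_locales (simp_all add: a_def c_def)
qed

section \<open>Presentation of the primary part\<close>

text \<open>Compare powers of \<open>p\<close>: the left side contains exactly \<open>p ^ a\<close>,
  the right side at least \<open>p ^ n\<close>. Applied to \<open>r * s = int m * int v\<close>, it
  yields \<open>\<gamma> \<le> a\<close>.\<close>

lemma power_exponent_le:
  fixes p r s s' c v' :: int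
  assumes p: "prime p" and pr: "\<not> p dvd r" and s': "\<not> p dvd s'" and eq: "r * (p ^ a * s') = c * (p ^ n * v')"
  shows "n \<le> a"
proof (rule ccontr)
  assume "\<not> ?thesis"
  then have "Suc a \<le> n" by simp
  then have "p ^ Suc a dvd p ^ n" by (rule le_imp_power_dvd)
  then have "p ^ Suc a dvd c * (p ^ n * v')" by (intro dvd_mult dvd_mult2)
  then have "p ^ a * p dvd p ^ a * (r * s')"
    unfolding eq[symmetric] by (simp only: power_Suc2 mult.left_commute)
  then have "p dvd r * s'" using p by auto
  then show False using p pr s' by (auto simp: prime_dvd_mult_iff)
qed

context integral_srg
begin

definition e0 :: "nat \<Rightarrow> int" where "e0 i = of_bool (i = 0)"

text \<open>This is \<open>(L - r) (v e0 - 1)\<close> expanded; since \<open>L\<close> annihilates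
  constants, the all-one vector leaves only the summand \<open>r\<close>.\<close>

definition u0 :: "nat \<Rightarrow> int" where "u0 i = int v * (L e0 i - r * e0 i) + r"

lemma sum_e0: "(\<Sum>i<v. e0 i) = 1"
  using v_pos by (simp add: e0_def Int_absorb1)

lemma eigvec_u0: "eigvec s u0"
proof -
  define z where "z i = int v * e0 i + (-1) * 1" for i
  have "(\<Sum>i<v. z i) = 0"
    using sum_e0 by (simp add: z_def sum_subtractf flip: sum_distrib_left)
  then have z: "eigvec s (\<lambda>i. L z i - r * z i)" by (rule eigvec_s_proj)
  have "L z i = int v * L e0 i" if "i < v" for i
    unfolding z_def[abs_def] lap_lincomb by (simp add: lap_const[OF srg that])
  then have eq: "L z i - r * z i = u0 i" if "i < v" for i
    using that by (simp add: z_def u0_def algebra_simps)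
  show ?thesis
    using z eq lap_cong[of v "\<lambda>i. L z i - r * z i" u0 _ E k, OF eq] by (simp add: eigvec_def)
qed

context
  fixes p s' v' :: int and a \<gamma> :: nat
  assumes p: "prime p" and pr: "\<not> p dvd r"
    and s': "s = p ^ a * s'" "\<not> p dvd s'" and v': "int v = p ^ \<gamma> * v'" "\<not> p dvd v'"
begin

lemma gamma_le: "\<gamma> \<le> a"
proof (rule power_exponent_le[OF p pr s'(2)])
  show "r * (p ^ a * s') = int m * (p ^ \<gamma> * v')"
    by (simp only: rs_eq flip: s'(1) v'(1))
qed

text \<open>If \<open>\<gamma> > 0\<close>, then \<open>p\<close> divides \<open>v\<close> and
  \<open>u0\<close> is congruent to \<open>r\<close> modulo \<open>p\<close>, so \<open>u0\<close>
  with pivot \<open>0\<close> starts the family. Otherwise the construction starts from the empty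
  family.\<close>

lemma exists_adapted_family:
  obtains b j h where "pivoted v p (eigvec s) b j h" "pivot_maximal v (eigvec s) j h"
    "\<gamma> > 0 \<Longrightarrow> h > 0 \<and> b 0 = u0"
proof -
  have p0: "p \<noteq> 0" using p by auto
  have "pivoted v p (eigvec s) (\<lambda>_. u0) (\<lambda>_. 0) (of_bool (\<gamma> > 0))"
  proof (cases "\<gamma> > 0")
    case True
    then have "p dvd int v" using v' by simp
    then have "\<not> p dvd u0 0" using pr by (simp add: u0_def dvd_add_right_iff)
    then show ?thesis using True eigvec_u0 v_pos by (simp add: pivoted_def)
  qed (simp add: pivoted_def)
  from pivoted_maximal_exists[OF this p eigvec_saturated[OF p0]]
  obtain b j h where "pivoted v p (eigvec s) b j h" "pivot_maximal v (eigvec s) j h"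
    "of_bool (\<gamma> > 0) \<le> h" "\<And>i. i < of_bool (\<gamma> > 0) \<Longrightarrow> b i = u0" by metis
  then show ?thesis by (intro that[of b j h]) auto
qed

text \<open>The relation \<open>s u0 = v L (L - r) e0\<close>, divided by
  \<open>p ^ \<gamma>\<close>. It is the reason why the first cyclic factor has order
  \<open>p ^ (a - \<gamma>)\<close>.\<close>

lemma u0_image: "i < v \<Longrightarrow> s' * p ^ (a - \<gamma>) * u0 i = L (\<lambda>i. v' * (L e0 i - r * e0 i)) i"
proof -
  assume i: "i < v"
  have "p ^ \<gamma> * (s' * p ^ (a - \<gamma>) * u0 i) = s * u0 i"
    using s' power_add[of p \<gamma> "a - \<gamma>"] gamma_le by (simp add: algebra_simps)
  also have "\<dots> = int v * (s * (L e0 i - r * e0 i)) + int m * int v"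
    by (simp add: u0_def algebra_simps flip: rs_eq)
  also have "\<dots> = int v * (L (L e0) i - r * L e0 i)"
    using i by (simp add: L_L sum_e0 algebra_simps)
  also have "\<dots> = p ^ \<gamma> * L (\<lambda>i. v' * (L e0 i - r * e0 i)) i"
    using v' by (simp add: lap_scale L_minus_scale)
  finally show ?thesis using p by simp
qed

context
  fixes b j h
  assumes piv: "pivoted v p (eigvec s) b j h" and max: "pivot_maximal v (eigvec s) j h"
    and b0: "\<gamma> > 0 \<Longrightarrow> h > 0 \<and> b 0 = u0"
begin

lemma eigvec_comb: "eigvec s (\<lambda>i. \<Sum>t<h. c t * b t i)"
  using piv by (simp add: eigvec_def pivoted_def lap_sum sum_distrib_left mult.left_commute)

text \<open>The kernel of the presentation. One direction treats the terms separately, by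
  \<open>u0_image\<close> for a leading \<open>u0\<close> and by \<open>L b = s b\<close> otherwise.
  For the other, \<open>key\<close> shows that a unit multiple of the combination is
  \<open>p ^ (a - \<gamma>)\<close> times a multiple of \<open>u0\<close>, modulo
  \<open>p ^ a\<close>; independence then applies to each coefficient.\<close>

lemma comb_in_image_iff:
  "(\<exists>z. \<forall>i<v. s' * (\<Sum>t<h. c t * b t i) = L z i) \<longleftrightarrow>
    (\<forall>t<h. p ^ (if t = 0 then a - \<gamma> else a) dvd c t)"
proof
  assume dvd: "\<forall>t<h. p ^ (if t = 0 then a - \<gamma> else a) dvd c t"
  have "\<exists>z. \<forall>i<v. s' * (c t * b t i) = L z i" if t: "t < h" for t
  \<comment> \<open>For \<open>\<gamma> = 0\<close> the leading member need not be
    \<open>u0\<close>, but then its exponent is \<open>a\<close> like all the others.\<close>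
  proof (cases "t = 0 \<and> \<gamma> > 0")
    case True
    then obtain d where "c t = p ^ (a - \<gamma>) * d" using dvd[rule_format, OF t] by (auto elim!: dvdE)
    then have "s' * (c t * b t i) = L (\<lambda>i. d * (v' * (L e0 i - r * e0 i))) i" if "i < v" for i
      using True b0 u0_image[OF that] by (simp only: lap_scale) (simp add: algebra_simps)
    then show ?thesis by blast
  next
    case False
    then obtain d where "c t = p ^ a * d" using dvd[rule_format, OF t] by (auto elim!: dvdE split: if_splits)
    then have "s' * (c t * b t i) = L (\<lambda>i. d * b t i) i" if "i < v" for i
      using piv t that s' by (simp add: pivoted_def eigvec_def lap_scale)
    then show ?thesis by blast
  qed
  then obtain z where z: "\<And>t i. t < h \<Longrightarrow> i < v \<Longrightarrow> s' * (c t * b t i) = L (z t) i" by metis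
  have "s' * (\<Sum>t<h. c t * b t i) = L (\<lambda>i. \<Sum>t<h. 1 * z t i) i" if "i < v" for i
    unfolding lap_sum using z that by (simp add: sum_distrib_left)
  then show "\<exists>z. \<forall>i<v. s' * (\<Sum>t<h. c t * b t i) = L z i" by blast
next
  assume "\<exists>z. \<forall>i<v. s' * (\<Sum>t<h. c t * b t i) = L z i"
  then obtain z where z: "\<And>i. i < v \<Longrightarrow> s' * (\<Sum>t<h. c t * b t i) = L z i" by blast
  define x where "x i = (\<Sum>t<h. c t * b t i)" for i
  define \<sigma> where "\<sigma> = (\<Sum>i<v. z i)"
  \<comment> \<open>This is \<open>(L - r) (z - \<sigma> e0)\<close>: the preimage is corrected to
    sum zero, and the removed part accounts for the multiple of \<open>u0\<close>.\<close>
  define y where "y i = L z i - r * z i - \<sigma> * (L e0 i - r * e0 i)" for i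
  have nz: "p \<noteq> 0" "s' \<noteq> 0" using p s' by auto
  have pa: "p ^ a = p ^ \<gamma> * p ^ (a - \<gamma>)" using gamma_le by (simp flip: power_add)
  \<comment> \<open>Compute \<open>L (L z)\<close> both from \<open>L z = s' x\<close> and from the
    quadratic equation. Multiplying by \<open>v\<close> turns \<open>m\<close> into
    \<open>r s\<close>, after which \<open>s' * p ^ \<gamma>\<close> cancels.\<close>
  have key: "v' * (s - r) * x i = p ^ a * (v' * y i) + p ^ (a - \<gamma>) * \<sigma> * u0 i" if i: "i < v" for i
  proof -
    have "L (L z) i = L (\<lambda>i. s' * x i) i"
      by (rule lap_cong[OF _ i]) (simp add: z x_def)
    also have "\<dots> = s' * (s * x i)"
      using eigvec_comb[of c] i by (simp add: lap_scale eigvec_def x_def[abs_def])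
    finally have "s' * (s * x i) = (r + s) * (s' * x i) - r * s * z i + int m * \<sigma>"
      using L_L[OF i, of z] z[OF i] by (simp add: \<sigma>_def x_def)
    then have eq: "s' * (s - r) * x i = s * (L z i - r * z i) + int m * \<sigma>"
      using z[OF i] by (simp add: x_def algebra_simps)
    have "int v * (s' * (s - r) * x i) = int v * (s * (L z i - r * z i)) + (int m * int v) * \<sigma>"
      unfolding eq by (simp only: distrib_left mult.commute mult.left_commute)
    also have "\<dots> = s * (int v * y i + \<sigma> * u0 i)"
      by (simp add: y_def u0_def algebra_simps flip: rs_eq)
    finally have "(s' * p ^ \<gamma>) * (v' * (s - r) * x i) = s * (int v * y i + \<sigma> * u0 i)"
      unfolding v'(1) by (simp only: mult.assoc mult.commute mult.left_commute)
    also have "\<dots> = (s' * p ^ \<gamma>) * (p ^ (a - \<gamma>) * (int v * y i + \<sigma> * u0 i))"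
      by (subst s'(1)) (simp only: pa mult.assoc mult.commute mult.left_commute)
    finally have "v' * (s - r) * x i = p ^ (a - \<gamma>) * (int v * y i + \<sigma> * u0 i)" using nz by simp
    also have "\<dots> = (p ^ (a - \<gamma>) * p ^ \<gamma>) * (v' * y i) + p ^ (a - \<gamma>) * \<sigma> * u0 i"
      using v' by (simp add: algebra_simps)
    also have "p ^ (a - \<gamma>) * p ^ \<gamma> = p ^ a" by (simp add: pa)
    finally show ?thesis .
  qed
  \<comment> \<open>The \<open>u0\<close> term is moved into the leading coefficient. If
    \<open>\<gamma> = 0\<close>, that term is itself divisible by \<open>p ^ a\<close> and can
    stay.\<close>
  define c' where "c' t = v' * (s - r) * c t - (if t = 0 \<and> \<gamma> > 0 then p ^ (a - \<gamma>) * \<sigma> else 0)" for t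
  have c': "p ^ a dvd c' t" if "t < h" for t
  proof (rule pivoted_independent_mod[OF piv p _ that])
    fix i assume i: "i < v"
    have "(\<Sum>t<h. c' t * b t i) = v' * (s - r) * x i
        - (\<Sum>t<h. if t = 0 then (if \<gamma> > 0 then p ^ (a - \<gamma>) * \<sigma> * b 0 i else 0) else 0)"
      unfolding c'_def x_def sum_distrib_left sum_subtractf[symmetric]
      by (intro sum.cong refl) (auto simp: algebra_simps)
    also have "(\<Sum>t<h. if t = 0 then (if \<gamma> > 0 then p ^ (a - \<gamma>) * \<sigma> * b 0 i else 0) else 0)
        = (if \<gamma> > 0 then p ^ (a - \<gamma>) * \<sigma> * u0 i else 0)"
      using b0 by (auto simp: sum.delta)
    finally show "p ^ a dvd (\<Sum>t<h. c' t * b t i)"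
      by (auto simp: key[OF i])
  qed
  show "\<forall>t<h. p ^ (if t = 0 then a - \<gamma> else a) dvd c t"
  proof (intro allI impI)
    fix t assume t: "t < h"
    define q where "q = p ^ (if t = 0 then a - \<gamma> else a)"
    have "q dvd p ^ a" by (simp add: q_def le_imp_power_dvd)
    then have "q dvd c' t" using c'[OF t] by (rule dvd_trans)
    moreover have "q dvd (if t = 0 \<and> \<gamma> > 0 then p ^ (a - \<gamma>) * \<sigma> else 0)" by (simp add: q_def)
    ultimately have "q dvd c' t + (if t = 0 \<and> \<gamma> > 0 then p ^ (a - \<gamma>) * \<sigma> else 0)"
      by (rule dvd_add)
    then have "q dvd v' * (s - r) * c t" by (simp only: c'_def diff_add_cancel)
    \<comment> \<open>For \<open>a > 0\<close>, \<open>p\<close> divides \<open>s\<close> but not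
      \<open>r\<close>, hence not \<open>s - r\<close>; for \<open>a = 0\<close>, \<open>q\<close>
      is \<open>1\<close>.\<close>
    moreover have "coprime q (v' * (s - r))"
    proof (cases "a = 0")
      case False
      then have "p dvd s" using s' by simp
      then have "\<not> p dvd s - r" using pr by (simp add: dvd_diff_right_iff)
      then have "\<not> p dvd v' * (s - r)" using p v' by (simp add: prime_dvd_mult_iff)
      then have "coprime p (v' * (s - r))" using p by (rule prime_imp_coprime[rotated])
      then show ?thesis unfolding q_def by (simp only: coprime_power_left_iff simp_thms)
    qed (simp add: q_def)
    ultimately show "p ^ (if t = 0 then a - \<gamma> else a) dvd c t"
      by (simp add: coprime_dvd_mult_right_iff q_def)
  qed
qed

text \<open>The vector \<open>(L - r) x\<close> lies in the eigenlattice and represents the class of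
  \<open>- r x\<close>. Hence \<open>M x\<close> is, modulo the image, \<open>s'\<close> times a
  combination of the family. As \<open>p ^ n\<close> annihilates the class of \<open>x\<close> and
  \<open>M\<close> is prime to \<open>p\<close>, Bezout inverts \<open>M\<close>.\<close>

lemma primary_is_comb:
  assumes sx: "(\<Sum>i<v. x i) = 0" and px: "\<And>i. i < v \<Longrightarrow> p ^ n * x i = L w i"
  shows "\<exists>c z. \<forall>i<v. x i - s' * (\<Sum>t<h. c t * b t i) = L z i"
proof -
  obtain N c where N: "\<not> p dvd N" and c: "\<And>i. i < v \<Longrightarrow> N * (L x i - r * x i) = (\<Sum>t<h. c t * b t i)"
    using pivoted_spans[OF piv max p eigvec_lincomb eigvec_s_proj[OF sx]] by metis
  define M where "M = - (s' * N * r)"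
  have "\<not> p dvd M" using p N pr s' by (simp add: M_def prime_dvd_mult_iff)
  then have "coprime (p ^ n) M" using p by (simp add: prime_imp_coprime)
  then have "gcd (p ^ n) M = 1" by (rule coprime_imp_gcd_eq_1)
  then obtain f g where fg: "f * p ^ n + g * M = 1"
    using bezout_int[of "p ^ n" M] by metis
  have "x i - s' * (\<Sum>t<h. (g * c t) * b t i) = L (\<lambda>i. f * w i + (- (g * s' * N)) * x i) i" if i: "i < v" for i
  proof -
    have "x i = (f * p ^ n + g * M) * x i" unfolding fg by simp
    also have "\<dots> = f * (p ^ n * x i) - g * s' * N * r * x i"
      by (simp add: M_def algebra_simps)
    also have "p ^ n * x i = L w i" by (rule px[OF i])
    finally have 1: "x i = f * L w i - g * s' * N * r * x i" .
    have "s' * (\<Sum>t<h. (g * c t) * b t i) = s' * g * (\<Sum>t<h. c t * b t i)"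
      by (simp add: sum_distrib_left mult.assoc mult.left_commute)
    also have "\<dots> = s' * g * (N * (L x i - r * x i))" by (simp add: c[OF i])
    finally have 2: "s' * (\<Sum>t<h. (g * c t) * b t i) = s' * g * (N * (L x i - r * x i))" .
    have "f * L w i + - (g * s' * N) * L x i =
        (f * L w i - g * s' * N * r * x i) - s' * g * (N * (L x i - r * x i))"
      by (simp add: algebra_simps)
    then show ?thesis by (simp only: lap_lincomb 2 1[symmetric])
  qed
  then show ?thesis by (intro exI[of _ "\<lambda>t. g * c t"] exI[of _ "\<lambda>i. f * w i + (- (g * s' * N)) * x i"] allI impI)
qed

lemma comb_primary: "i < v \<Longrightarrow> p ^ a * (s' * (\<Sum>t<h. c t * b t i)) = L (\<lambda>i. \<Sum>t<h. c t * b t i) i"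
  using eigvec_comb[of c] s' by (simp add: eigvec_def)

end
end
end

section \<open>The Sylow subgroup of the critical group\<close>

text \<open>The index \<open>q\<close> of \<open>P\<close> is prime to \<open>p\<close>, and
  \<open>x [^] q\<close> lies in \<open>P\<close> by Lagrange in the quotient. If \<open>x\<close>
  has \<open>p\<close>-power order, Bezout writes it as a power of \<open>x [^] q\<close>.\<close>

lemma (in comm_group) sylow_subgroup_mem_iff:
  assumes fin: "finite (carrier G)" and p: "prime p" and P: "sylow_subgroup G p P"
  shows "x \<in> P \<longleftrightarrow> x \<in> carrier G \<and> (\<exists>n. x [^] (p ^ n :: nat) = \<one>)"
proof
  have sub: "subgroup P G" and card: "card P = p ^ multiplicity p (Coset.order G)"
    using P by (auto simp: sylow_subgroup_def Coset.order_def)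
  {
    assume x: "x \<in> P"
    interpret P: group "G\<lparr>carrier := P\<rparr>" by (rule subgroup_imp_group[OF sub])
    have "finite P" using fin subgroup.subset[OF sub] finite_subset by blast
    then have "x [^]\<^bsub>G\<lparr>carrier := P\<rparr>\<^esub> card P = \<one>"
      using P.pow_order_eq_1[of x] x by (simp add: Coset.order_def)
    then have "x [^] (p ^ multiplicity p (Coset.order G)) = \<one>"
      unfolding card by (simp add: nat_pow_consistent[of _ _ P])
    then show "x \<in> carrier G \<and> (\<exists>n. x [^] (p ^ n) = \<one>)"
      using x subgroup.subset[OF sub] by blast
  next
    assume "x \<in> carrier G \<and> (\<exists>n. x [^] (p ^ n) = \<one>)"
    then obtain n where x: "x \<in> carrier G" and n: "x [^] (p ^ n) = \<one>" by blast
    interpret N: normal P G by (rule subgroup_imp_normal[OF sub])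
    interpret Q: group "G Mod P" by (rule N.factorgroup_is_group)
    define q where "q = card (rcosets P)"
    have lag: "q * p ^ multiplicity p (Coset.order G) = Coset.order G"
      using lagrange[OF sub] by (simp add: q_def card)
    have "Coset.order G \<noteq> 0" using fin order_gt_0_iff_finite by simp
    have "\<not> p dvd q"
    proof
      assume "p dvd q"
      then have "p ^ Suc (multiplicity p (Coset.order G)) dvd q * p ^ multiplicity p (Coset.order G)"
        by (simp add: mult_dvd_mono)
      then have "Suc (multiplicity p (Coset.order G)) \<le> multiplicity p (Coset.order G)"
        unfolding lag using \<open>Coset.order G \<noteq> 0\<close> p by (intro multiplicity_geI) (auto simp: not_prime_unit)
      then show False by simp
    qed
    then have "coprime p q" by (rule prime_imp_coprime[OF p])
    then have "coprime (int (p ^ n)) (int q)" by (simp only: coprime_int_iff coprime_power_left_iff simp_thms)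
    then have "gcd (int (p ^ n)) (int q) = 1" by (rule coprime_imp_gcd_eq_1)
    then obtain a b where ab: "a * int (p ^ n) + b * int q = 1"
      using bezout_int[of "int (p ^ n)" "int q"] by metis
    have "finite (carrier (G Mod P))"
      using fin by (simp add: carrier_FactGroup)
    then have "(P #> x) [^]\<^bsub>G Mod P\<^esub> q = \<one>\<^bsub>G Mod P\<^esub>"
      using Q.pow_order_eq_1[of "P #> x"] x by (auto simp: Coset.order_def q_def carrier_FactGroup FactGroup_def RCOSETS_def)
    then have "P #> (x [^] q) = P" using x by (simp add: N.FactGroup_pow)
    then have xq: "x [^] q \<in> P" using x sub coset_join1 by simp
    have "x = x [^] (int (p ^ n) * a + int q * b)"
      using ab x by (simp add: mult.commute int_pow_1 del: of_nat_power)
    also have "\<dots> = (x [^] int (p ^ n)) [^] a \<otimes> (x [^] int q) [^] b"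
      using x by (simp only: int_pow_mult int_pow_pow)
    also have "\<dots> = (x [^] q) [^] b"
      using n x by (simp only: int_pow_int) simp
    also have "\<dots> \<in> P"
      using xq sub by (simp add: int_pow_consistent[OF sub xq] group.int_pow_closed[OF subgroup_imp_group[OF sub], simplified])
    finally show "x \<in> P" .
  }
qed

text \<open>Coordinatewise reduction \<open>\<theta>\<close> and \<open>\<psi>\<close> have the same
  kernel, so \<open>H\<close> and the product are quotients of the lattice by the same
  subgroup.\<close>

lemma iso_product_integer_mod_group:
  assumes grp: "group H" and hom: "\<psi> \<in> hom (int_lattice h) H"
    and onto: "\<psi> ` carrier (int_lattice h) = carrier H"
    and ker: "\<And>c. c \<in> carrier (int_lattice h) \<Longrightarrow> \<psi> c = \<one>\<^bsub>H\<^esub> \<longleftrightarrow> (\<forall>t<h. int (q t) dvd c t)"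
  shows "H \<cong> product_group {..<h} (\<lambda>t. integer_mod_group (q t))" (is "_ \<cong> ?M")
proof -
  have Z: "group (int_lattice h)" by (simp add: int_lattice_def)
  have M: "group ?M" by simp
  define \<theta> where "\<theta> c = (\<lambda>t\<in>{..<h}. c t mod int (q t))" for c :: "nat \<Rightarrow> int"
  have modc: "x mod int n \<in> carrier (integer_mod_group n)" for x n
    by (auto simp: carrier_integer_mod_group)
  have \<theta>: "\<theta> \<in> hom (int_lattice h) ?M"
  proof (rule homI)
    show "\<theta> c \<in> carrier ?M" for c by (simp add: \<theta>_def modc)
    show "\<theta> (c \<otimes>\<^bsub>int_lattice h\<^esub> d) = \<theta> c \<otimes>\<^bsub>?M\<^esub> \<theta> d" for c d
      unfolding mult_product_group \<theta>_def[of "c \<otimes>\<^bsub>int_lattice h\<^esub> d"]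
      by (intro restrict_ext) (simp add: \<theta>_def int_lattice_def mod_add_eq)
  qed
  have \<theta>_id: "\<theta> c = c" if "c \<in> carrier ?M" for c
  proof
    fix t
    have "c t \<in> carrier (integer_mod_group (q t))" if "t < h"
      using PiE_mem[of c "{..<h}" "\<lambda>i. carrier (integer_mod_group (q i))" t] \<open>c \<in> carrier ?M\<close> that by simp
    \<comment> \<open>For \<open>q t = 0\<close> the factor is the group of all integers, and
      reduction modulo \<open>0\<close> is the identity.\<close>
    then have "c t mod int (q t) = c t" if "t < h"
      using that by (cases "q t = 0") (simp_all add: carrier_integer_mod_group)
    moreover have "c t = undefined" if "\<not> t < h"
      using \<open>c \<in> carrier ?M\<close> that by (intro PiE_arb[of c "{..<h}"]) simp_all
    ultimately show "\<theta> c t = c t" by (simp add: \<theta>_def)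
  qed
  have M_sub: "carrier ?M \<subseteq> carrier (int_lattice h)"
    by (auto simp: int_lattice_def)
  have \<theta>_onto: "\<theta> ` carrier (int_lattice h) = carrier ?M"
  proof
    show "carrier ?M \<subseteq> \<theta> ` carrier (int_lattice h)"
    proof
      fix c assume c: "c \<in> carrier ?M"
      then have "c \<in> carrier (int_lattice h)" by (rule subsetD[OF M_sub])
      then have "\<theta> c \<in> \<theta> ` carrier (int_lattice h)" by (rule imageI)
      then show "c \<in> \<theta> ` carrier (int_lattice h)" by (simp only: \<theta>_id[OF c])
    qed
  qed (rule hom_carrier[OF \<theta>])
  have "\<theta> c = \<one>\<^bsub>?M\<^esub> \<longleftrightarrow> (\<forall>t<h. int (q t) dvd c t)" for c
    unfolding \<theta>_def one_product_group one_integer_mod_group dvd_eq_mod_eq_0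
    by (metis (mono_tags, lifting) lessThan_iff restrict_apply' restrict_ext)
  then have kers: "kernel (int_lattice h) ?M \<theta> = kernel (int_lattice h) H \<psi>"
    using ker by (auto simp: kernel_def)
  have 1: "int_lattice h Mod kernel (int_lattice h) H \<psi> \<cong> H"
    using Z grp hom onto by (intro group_hom.FactGroup_iso) (auto simp: group_hom_def group_hom_axioms_def)
  have 2: "int_lattice h Mod kernel (int_lattice h) ?M \<theta> \<cong> ?M"
    using Z M \<theta> \<theta>_onto by (intro group_hom.FactGroup_iso) (auto simp: group_hom_def group_hom_axioms_def)
  have "group (int_lattice h Mod kernel (int_lattice h) H \<psi>)"
    using Z grp hom
    by (intro normal.factorgroup_is_group group_hom.normal_kernel) (auto simp: group_hom_def group_hom_axioms_def)
  then have "H \<cong> int_lattice h Mod kernel (int_lattice h) H \<psi>"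
    using 1 by (rule group.iso_sym)
  then show ?thesis using 2 unfolding kers by (rule iso_trans)
qed

lemma comm_group_int_lattice: "comm_group (int_lattice n)"
proof -
  have "group (int_lattice n)" by (simp add: int_lattice_def)
  then show ?thesis
    by (rule group.group_comm_groupI) (auto simp: int_lattice_def add.commute)
qed

section \<open>The cokernel as classes of integer vectors\<close>

context integral_srg
begin

abbreviation Z where "Z \<equiv> int_lattice v"

definition im :: "(nat \<Rightarrow> int) set" where "im = laplacian_map v E ` carrier Z"

lemma cokernel_eq: "cokernel_L v E = Z Mod im"
  by (simp only: cokernel_L_def im_def)

text \<open>The restriction lets an arbitrary function name a coset, so formulas about
  \<open>L\<close> apply without extensionality conditions.\<close>

definition cls :: "(nat \<Rightarrow> int) \<Rightarrow> (nat \<Rightarrow> int) set" where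
  "cls x = im #>\<^bsub>Z\<^esub> restrict x {..<v}"

interpretation Z: comm_group Z by (rule comm_group_int_lattice)

lemma restrict_in_Z: "restrict x {..<v} \<in> carrier Z"
  by (simp add: int_lattice_def)

lemma mem_im_iff: "restrict x {..<v} \<in> im \<longleftrightarrow> (\<exists>z. \<forall>i<v. x i = L z i)"
proof -
  have lm: "laplacian_map v E z = restrict (L z) {..<v}" for z
    using srg by (auto simp: laplacian_map_def lap_def strongly_regular_def)
  show ?thesis
  proof
    assume "restrict x {..<v} \<in> im"
    then obtain z where eq: "restrict x {..<v} = restrict (L z) {..<v}" by (auto simp only: lm im_def)
    have "x i = L z i" if "i < v" for i using fun_cong[OF eq, of i] that by simp
    then show "\<exists>z. \<forall>i<v. x i = L z i" by blast
  next
    assume "\<exists>z. \<forall>i<v. x i = L z i"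
    then obtain z where z: "\<forall>i<v. x i = L z i" by blast
    have "restrict x {..<v} = laplacian_map v E (restrict z {..<v})"
      unfolding lm using z lap_cong[of v "restrict z {..<v}" z _ E k]
      by (intro restrict_ext) simp
    then show "restrict x {..<v} \<in> im" using restrict_in_Z[of z] by (simp only: im_def imageI)
  qed
qed

lemma Z_restrict: "x \<in> carrier Z \<Longrightarrow> restrict x {..<v} = x"
  by (simp add: int_lattice_def PiE_iff extensional_restrict)

lemma mult_Z: "restrict x {..<v} \<otimes>\<^bsub>Z\<^esub> restrict y {..<v} = restrict (\<lambda>i. x i + y i) {..<v}"
  by (auto simp: int_lattice_def)

lemma inv_Z: "inv\<^bsub>Z\<^esub> (restrict x {..<v}) = restrict (\<lambda>i. - x i) {..<v}"
  using restrict_in_Z[of x] by (auto simp: int_lattice_def)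

lemma subgroup_im: "subgroup im Z"
proof (rule Z.subgroupI)
  have "laplacian_map v E x \<in> carrier Z" for x
    unfolding laplacian_map_def by (rule restrict_in_Z)
  then have Z_im: "im \<subseteq> carrier Z" unfolding im_def by blast
  then show "im \<subseteq> carrier Z" .
  show "im \<noteq> {}" using Z.one_closed by (auto simp only: im_def)
  show "inv\<^bsub>Z\<^esub> x \<in> im" if x: "x \<in> im" for x
  proof -
    have rx: "restrict x {..<v} = x" using x Z_im Z_restrict by blast
    then have "restrict x {..<v} \<in> im" using x by (simp only:)
    then obtain z where "\<forall>i<v. x i = L z i" unfolding mem_im_iff by blast
    then have "\<forall>i<v. - x i = L (\<lambda>i. - 1 * z i) i" by (simp only: lap_scale) simp
    then have "restrict (\<lambda>i. - x i) {..<v} \<in> im" unfolding mem_im_iff by blast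
    then show ?thesis unfolding inv_Z[symmetric] rx .
  qed
  show "x \<otimes>\<^bsub>Z\<^esub> y \<in> im" if x: "x \<in> im" and y: "y \<in> im" for x y
  proof -
    have rx: "restrict x {..<v} = x" "restrict y {..<v} = y" using x y Z_im Z_restrict by blast+
    then have "restrict x {..<v} \<in> im" "restrict y {..<v} \<in> im" using x y by (simp_all only:)
    then obtain z w where "\<forall>i<v. x i = L z i" "\<forall>i<v. y i = L w i" unfolding mem_im_iff by blast
    then have "\<forall>i<v. x i + y i = L (\<lambda>i. 1 * z i + 1 * w i) i" by (simp only: lap_lincomb) simp
    then have "restrict (\<lambda>i. x i + y i) {..<v} \<in> im" unfolding mem_im_iff by blast
    then show ?thesis unfolding mult_Z[symmetric] rx .
  qed
qed

interpretation im: normal im Z by (rule Z.subgroup_imp_normal[OF subgroup_im])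

lemma comm_group_cokernel: "comm_group (cokernel_L v E)"
  unfolding cokernel_eq by (rule Z.abelian_FactGroup[OF subgroup_im])

lemma carrier_cokernel: "carrier (cokernel_L v E) = range cls"
proof -
  have "carrier Z = range (\<lambda>x. restrict x {..<v})"
  proof (intro equalityI subsetI)
    show "x \<in> range (\<lambda>x. restrict x {..<v})" if "x \<in> carrier Z" for x
      using Z_restrict[OF that] by (intro range_eqI[of x _ x]) simp
  qed (use restrict_in_Z in \<open>elim rangeE, simp only:\<close>)
  then show ?thesis
    unfolding cokernel_eq carrier_FactGroup cls_def by (simp only: image_image)
qed

lemma mult_cls: "cls x \<otimes>\<^bsub>cokernel_L v E\<^esub> cls y = cls (\<lambda>i. x i + y i)"
  unfolding cls_def cokernel_eq mult_FactGroup
  by (simp add: im.rcos_sum restrict_in_Z mult_Z)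

lemma one_cls: "\<one>\<^bsub>cokernel_L v E\<^esub> = im"
  by (simp add: cokernel_eq)

lemma cls_eq_one_iff: "cls x = im \<longleftrightarrow> (\<exists>z. \<forall>i<v. x i = L z i)"
  unfolding cls_def mem_im_iff[symmetric]
  using Z.coset_join1[OF _ restrict_in_Z subgroup_im] Z.coset_join2[OF restrict_in_Z subgroup_im] by auto

lemma cls_zero: "cls (\<lambda>_. 0) = im"
  unfolding cls_eq_one_iff using lap_const[OF srg, of _ "0 :: int"] by (intro exI[of _ "\<lambda>_. 0"]) simp

lemma pow_cls: "cls x [^]\<^bsub>cokernel_L v E\<^esub> n = cls (\<lambda>i. int n * x i)"
proof (induction n)
  case 0
  then show ?case by (simp add: cls_zero one_cls)
next
  case (Suc n)
  then show ?case by (simp add: mult_cls algebra_simps)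
qed

lemma cls_eq_iff: "cls x = cls y \<longleftrightarrow> (\<exists>z. \<forall>i<v. x i - y i = L z i)"
proof -
  interpret C: comm_group "cokernel_L v E" by (rule comm_group_cokernel)
  have eq: "cls (\<lambda>i. x i - y i) \<otimes>\<^bsub>cokernel_L v E\<^esub> cls y = cls x" by (simp add: mult_cls)
  have carr: "cls z \<in> carrier (cokernel_L v E)" for z by (simp add: carrier_cokernel)
  have "cls x = cls y \<longleftrightarrow>
      cls (\<lambda>i. x i - y i) \<otimes>\<^bsub>cokernel_L v E\<^esub> cls y = \<one>\<^bsub>cokernel_L v E\<^esub> \<otimes>\<^bsub>cokernel_L v E\<^esub> cls y"
    unfolding eq by (simp only: C.l_one[OF carr])
  also have "\<dots> \<longleftrightarrow> cls (\<lambda>i. x i - y i) = \<one>\<^bsub>cokernel_L v E\<^esub>"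
    by (rule C.right_cancel[OF carr carr C.one_closed])
  finally have "cls x = cls y \<longleftrightarrow> cls (\<lambda>i. x i - y i) = \<one>\<^bsub>cokernel_L v E\<^esub>" .
  then show ?thesis by (simp add: one_cls cls_eq_one_iff)
qed

section \<open>The critical group as the classes of sum zero\<close>

lemma rs_sum_zero:
  assumes "(\<Sum>i<v. x i) = 0" "i < v"
  shows "r * s * x i = L (\<lambda>i. (r + s) * x i + (-1) * L x i) i"
  using L_L[OF assms(2), of x] assms(1) unfolding lap_lincomb by simp

text \<open>Images of \<open>L\<close> have sum zero, so a torsion class has sum zero; conversely
  \<open>r * s\<close> annihilates every class of sum zero, since \<open>L (r + s - L)\<close> acts
  there as \<open>r * s\<close>.\<close>

lemma carrier_critical_group: "carrier (critical_group v E) = cls ` {x. (\<Sum>i<v. x i) = 0}"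
proof -
  have "(\<exists>n::nat. n > 0 \<and> cls x [^]\<^bsub>cokernel_L v E\<^esub> n = \<one>\<^bsub>cokernel_L v E\<^esub>) \<longleftrightarrow> (\<Sum>i<v. x i) = 0" for x
  proof
    assume "\<exists>n::nat. n > 0 \<and> cls x [^]\<^bsub>cokernel_L v E\<^esub> n = \<one>\<^bsub>cokernel_L v E\<^esub>"
    then obtain n :: nat and z where n: "n > 0" and z: "\<forall>i<v. int n * x i = L z i"
      by (auto simp: pow_cls one_cls cls_eq_one_iff)
    have "int n * (\<Sum>i<v. x i) = (\<Sum>i<v. L z i)" using z by (simp add: sum_distrib_left)
    then show "(\<Sum>i<v. x i) = 0" using n sum_lap[OF srg, of z] by simp
  next
    assume x: "(\<Sum>i<v. x i) = 0"
    \<comment> \<open>The exponent must be a positive natural number, so the sign of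
      \<open>r * s\<close> is moved into the preimage.\<close>
    define n where "n = nat \<bar>r * s\<bar>"
    have n1: "n > 0" using rs by (simp add: n_def)
    have n2: "int n = sgn (r * s) * (r * s)"
      using abs_sgn[of "r * s"] by (simp add: n_def mult.commute)
    have "\<forall>i<v. int n * x i = L (\<lambda>i. sgn (r * s) * ((r + s) * x i + (-1) * L x i)) i"
      unfolding n2 lap_scale using rs_sum_zero[OF x] by (simp add: mult.assoc)
    then show "\<exists>n::nat. n > 0 \<and> cls x [^]\<^bsub>cokernel_L v E\<^esub> n = \<one>\<^bsub>cokernel_L v E\<^esub>"
      using n1 unfolding pow_cls one_cls cls_eq_one_iff by blast
  qed
  then show ?thesis
    unfolding critical_group_def torsion_subgroup_def by (auto simp: carrier_cokernel)
qed

lemma critical_group_eq: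
  "critical_group v E = (cokernel_L v E)\<lparr>carrier := cls ` {x. (\<Sum>i<v. x i) = 0}\<rparr>"
  using carrier_critical_group by (simp add: critical_group_def torsion_subgroup_def)

lemma comm_group_critical: "comm_group (critical_group v E)"
proof -
  interpret C: comm_group "cokernel_L v E" by (rule comm_group_cokernel)
  have "subgroup (cls ` {x. (\<Sum>i<v. x i) = 0}) (cokernel_L v E)"
  proof (rule C.subgroupI)
    show "inv\<^bsub>cokernel_L v E\<^esub> X \<in> cls ` {x. (\<Sum>i<v. x i) = 0}" if X: "X \<in> cls ` {x. (\<Sum>i<v. x i) = 0}" for X
    proof -
      obtain x where x: "X = cls x" "(\<Sum>i<v. x i) = 0" using X by auto
      have "cls (\<lambda>i. - x i) \<otimes>\<^bsub>cokernel_L v E\<^esub> cls x = \<one>\<^bsub>cokernel_L v E\<^esub>"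
        by (simp add: mult_cls one_cls cls_zero)
      then have "inv\<^bsub>cokernel_L v E\<^esub> X = cls (\<lambda>i. - x i)"
        unfolding x by (intro C.inv_equality) (auto simp: carrier_cokernel)
      then show ?thesis using x(2) by (auto simp: sum_negf)
    qed
    show "cls ` {x. (\<Sum>i<v. x i) = 0} \<noteq> {}" by (auto intro: exI[of _ "\<lambda>_. 0"])
  qed (auto simp: carrier_cokernel mult_cls sum.distrib)
  then show ?thesis unfolding critical_group_eq
    using C.subgroup_imp_group by (auto intro!: group.group_comm_groupI simp: carrier_cokernel C.m_comm)
qed

text \<open>A class of sum zero depends only on the residues modulo
  \<open>\<bar>r * s\<bar>\<close>: two congruent representatives differ by \<open>r * s\<close>
  times a vector of sum zero, which is an image.\<close>

lemma finite_critical_group: "finite (carrier (critical_group v E))"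
proof -
  define n where "n = \<bar>r * s\<bar>"
  define red where "red x = (\<lambda>i\<in>{..<v}. x i mod n)" for x
  have n: "n > 0" using rs by (simp add: n_def)
  have "cls x = cls y" if xy: "(\<Sum>i<v. x i) = 0" "(\<Sum>i<v. y i) = 0" "red x = red y" for x y
  proof -
    have "x i mod n = y i mod n" if "i < v" for i
      using xy(3) that by (metis lessThan_iff red_def restrict_apply')
    then have "\<forall>i. \<exists>d. i < v \<longrightarrow> x i - y i = r * s * d"
      by (metis abs_dvd_iff dvd_def mod_eq_dvd_iff n_def)
    then obtain d where d: "\<And>i. i < v \<Longrightarrow> x i - y i = r * s * d i" by metis
    have "r * s * (\<Sum>i<v. d i) = (\<Sum>i<v. x i - y i)" by (simp add: d sum_distrib_left)
    then have "(\<Sum>i<v. d i) = 0" using xy rs by (simp add: sum_subtractf)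
    then show ?thesis unfolding cls_eq_iff using rs_sum_zero[of d] d by auto
  qed
  \<comment> \<open>A chosen representative for each residue vector exhibits the carrier as the
    image of a finite set.\<close>
  then have "\<forall>x\<in>{x. (\<Sum>i<v. x i) = 0}. cls x = (\<lambda>m. cls (SOME x. (\<Sum>i<v. x i) = 0 \<and> red x = m)) (red x)"
    by (intro ballI) (metis (mono_tags, lifting) mem_Collect_eq someI_ex)
  then have sub: "cls ` {x. (\<Sum>i<v. x i) = 0} \<subseteq>
      (\<lambda>m. cls (SOME x. (\<Sum>i<v. x i) = 0 \<and> red x = m)) ` red ` {x. (\<Sum>i<v. x i) = 0}"
    by blast
  have "red ` {x. (\<Sum>i<v. x i) = 0} \<subseteq> PiE {..<v} (\<lambda>_. {0..<n})"
    using n by (intro image_subsetI) (simp add: red_def)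
  then have "finite (red ` {x. (\<Sum>i<v. x i) = 0})"
    by (rule finite_subset) (auto intro: finite_PiE)
  then show ?thesis
    unfolding carrier_critical_group by (rule finite_subset[OF sub finite_imageI])
qed

text \<open>The coefficient lattice maps onto \<open>P\<close> by \<open>primary_is_comb\<close>,
  with the kernel described by \<open>comb_in_image_iff\<close>; the number of coefficients is the
  multiplicity of \<open>s\<close>.\<close>

theorem sylow_critical_group_iso:
  fixes p a \<gamma> :: nat
  assumes p: "prime p" and pr: "\<not> int p dvd r"
    and a: "int p ^ a dvd s" "\<not> int p ^ (a + 1) dvd s"
    and \<gamma>: "p ^ \<gamma> dvd v" "\<not> p ^ (\<gamma> + 1) dvd v"
    and P: "sylow_subgroup (critical_group v E) p P"
    and g: "g = Polynomial.order (real_of_int s) (char_poly (laplacian_mat v E))"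
  shows "(critical_group v E)\<lparr>carrier := P\<rparr> \<cong>
    product_group {..<g} (\<lambda>i. integer_mod_group (if i = 0 then p ^ (a - \<gamma>) else p ^ a))"
proof -
  interpret K: comm_group "critical_group v E" by (rule comm_group_critical)
  have pp: "prime (int p)" using p by simp
  obtain s' where s': "s = int p ^ a * s'" using a(1) by blast
  have s'2: "\<not> int p dvd s'"
  proof
    assume "int p dvd s'"
    then have "int p ^ (a + 1) dvd s" unfolding s' by (simp add: mult.commute mult_dvd_mono)
    then show False using a(2) by simp
  qed
  obtain w where w: "v = p ^ \<gamma> * w" using \<gamma>(1) by blast
  have w2: "\<not> int p dvd int w"
  proof
    assume "int p dvd int w"
    then have "p ^ (\<gamma> + 1) dvd v" unfolding w by (simp add: mult.commute mult_dvd_mono)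
    then show False using \<gamma>(2) by simp
  qed
  have w1: "int v = int p ^ \<gamma> * int w" using w by (metis of_nat_mult of_nat_power)
  obtain b j h where piv: "pivoted v (int p) (eigvec s) b j h" and max: "pivot_maximal v (eigvec s) j h"
      and b0: "\<gamma> > 0 \<Longrightarrow> h > 0 \<and> b 0 = u0"
    using exists_adapted_family[OF pp pr s' s'2 w1 w2] by metis
  have gh: "g = h" unfolding g by (rule order_char_poly_s[OF pp piv max])
  note lattice = pp pr s' s'2 w1 w2 piv max b0
  have P_iff: "X \<in> P \<longleftrightarrow> (\<exists>x n z. X = cls x \<and> (\<Sum>i<v. x i) = 0 \<and> (\<forall>i<v. int p ^ n * x i = L z i))" for X
  proof -
    have "X \<in> P \<longleftrightarrow> (\<exists>x. X = cls x \<and> (\<Sum>i<v. x i) = 0 \<and> (\<exists>n. cls x [^]\<^bsub>cokernel_L v E\<^esub> (p ^ n) = im))"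
      unfolding K.sylow_subgroup_mem_iff[OF finite_critical_group p P] carrier_critical_group
      unfolding critical_group_eq by (auto simp: one_cls nat_pow_def)
    then show ?thesis unfolding pow_cls cls_eq_one_iff by simp
  qed
  \<comment> \<open>The factor \<open>s'\<close> makes the class \<open>p\<close>-primary:
    \<open>p ^ a\<close> times \<open>s' x\<close> is \<open>s x = L x\<close> for \<open>x\<close>
    in the eigenlattice.\<close>
  define \<psi> where "\<psi> c = cls (\<lambda>i. s' * (\<Sum>t<h. c t * b t i))" for c
  let ?H = "(critical_group v E)\<lparr>carrier := P\<rparr>"
  have grp: "group ?H" using P K.subgroup_imp_group by (auto simp: sylow_subgroup_def)
  have \<psi>P: "\<psi> c \<in> P" for c
  proof -
    have "(\<Sum>i<v. s' * (\<Sum>t<h. c t * b t i)) = 0"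
      using eigvec_sum_zero[OF eigvec_comb[OF lattice] rs(3)] by (simp flip: sum_distrib_left)
    then show ?thesis unfolding P_iff \<psi>_def using comb_primary[OF lattice] by blast
  qed
  have "?H \<cong> product_group {..<h} (\<lambda>i. integer_mod_group (if i = 0 then p ^ (a - \<gamma>) else p ^ a))"
  proof (rule iso_product_integer_mod_group[OF grp])
    show "\<psi> \<in> hom (int_lattice h) ?H"
    proof (rule homI)
      fix c d assume "c \<in> carrier (int_lattice h)" "d \<in> carrier (int_lattice h)"
      have "(\<Sum>t<h. (c \<otimes>\<^bsub>int_lattice h\<^esub> d) t * b t i) = (\<Sum>t<h. c t * b t i) + (\<Sum>t<h. d t * b t i)" for i
        by (simp add: int_lattice_def distrib_right sum.distrib)
      then show "\<psi> (c \<otimes>\<^bsub>int_lattice h\<^esub> d) = \<psi> c \<otimes>\<^bsub>?H\<^esub> \<psi> d"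
        by (simp add: \<psi>_def critical_group_eq mult_cls distrib_left)
    qed (simp add: \<psi>P)
    show "\<psi> ` carrier (int_lattice h) = carrier ?H"
    proof
      show "carrier ?H \<subseteq> \<psi> ` carrier (int_lattice h)"
      proof
        fix X assume "X \<in> carrier ?H"
        then obtain x n z where x: "X = cls x" "(\<Sum>i<v. x i) = 0" "\<And>i. i < v \<Longrightarrow> int p ^ n * x i = L z i"
          by (auto simp: P_iff)
        obtain c z' where "\<forall>i<v. x i - s' * (\<Sum>t<h. c t * b t i) = L z' i"
          using primary_is_comb[OF lattice x(2,3)] by blast
        then have "X = \<psi> c" unfolding x \<psi>_def cls_eq_iff by blast
        also have "\<dots> = \<psi> (restrict c {..<h})" by (simp add: \<psi>_def)
        finally show "X \<in> \<psi> ` carrier (int_lattice h)"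
          by (auto simp: int_lattice_def)
      qed
    qed (auto simp: \<psi>P)
    show "\<psi> c = \<one>\<^bsub>?H\<^esub> \<longleftrightarrow> (\<forall>t<h. int (if t = 0 then p ^ (a - \<gamma>) else p ^ a) dvd c t)" for c
    proof -
      have "\<psi> c = \<one>\<^bsub>?H\<^esub> \<longleftrightarrow> (\<exists>z. \<forall>i<v. s' * (\<Sum>t<h. c t * b t i) = L z i)"
        by (simp add: \<psi>_def critical_group_eq one_cls cls_eq_one_iff)
      also have "\<dots> \<longleftrightarrow> (\<forall>t<h. int p ^ (if t = 0 then a - \<gamma> else a) dvd c t)"
        by (rule comb_in_image_iff[OF lattice])
      finally show ?thesis by (auto split: if_splits)
    qed
  qed
  then show ?thesis by (simp only: gh)
qed

end

theorem theorem3p1: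
  fixes v k l m f g p :: nat and E :: "nat \<Rightarrow> nat \<Rightarrow> bool" and r s :: int
  assumes srg: "strongly_regular v E k l m"
    and conn: "connected_graph v E"
    and rs: "r \<noteq> s" "r \<noteq> 0" "s \<noteq> 0"
    and eig_r: "eigenvalue (laplacian_mat v E) (real_of_int r)"
    and eig_s: "eigenvalue (laplacian_mat v E) (real_of_int s)"
    and eig_all: "\<And>e. eigenvalue (laplacian_mat v E) e \<Longrightarrow> e \<in> {0, real_of_int r, real_of_int s}"
    and mult_f: "f = Polynomial.order (real_of_int r) (char_poly (laplacian_mat v E))"
    and mult_g: "g = Polynomial.order (real_of_int s) (char_poly (laplacian_mat v E))"
    and p: "prime p" "p dvd card (carrier (critical_group v E))"
  shows
    "(\<not> int p dvd r \<longrightarrow>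
       (\<forall>a \<gamma> P. int p ^ a dvd s \<and> \<not> int p ^ (a + 1) dvd s \<and>
                 p ^ \<gamma> dvd v \<and> \<not> p ^ (\<gamma> + 1) dvd v \<and>
                 sylow_subgroup (critical_group v E) p P \<longrightarrow>
          (critical_group v E)\<lparr>carrier := P\<rparr> \<cong>
            product_group {..<g} (\<lambda>i. integer_mod_group (if i = 0 then p ^ (a - \<gamma>) else p ^ a))))
   \<and> (\<not> int p dvd s \<longrightarrow>
       (\<forall>a \<gamma> P. int p ^ a dvd r \<and> \<not> int p ^ (a + 1) dvd r \<and>
                 p ^ \<gamma> dvd v \<and> \<not> p ^ (\<gamma> + 1) dvd v \<and>
                 sylow_subgroup (critical_group v E) p P \<longrightarrow>
          (critical_group v E)\<lparr>carrier := P\<rparr> \<cong>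
            product_group {..<f} (\<lambda>i. integer_mod_group (if i = 0 then p ^ (a - \<gamma>) else p ^ a))))"
proof -
  interpret rs: integral_srg v k l m E r s
    by (rule integral_srgI[OF srg rs eig_r eig_s])
  \<comment> \<open>Exchanging the eigenvalues gives the second half of the statement.\<close>
  interpret sr: integral_srg v k l m E s r
    by (rule integral_srgI[OF srg rs(1)[symmetric] rs(3,2) eig_s eig_r])
  show ?thesis
    by (intro conjI allI impI; elim conjE)
      (rule rs.sylow_critical_group_iso[OF p(1) _ _ _ _ _ _ mult_g]
        sr.sylow_critical_group_iso[OF p(1) _ _ _ _ _ _ mult_f]; assumption)+
qed

end
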